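(* Let $m,n,d,e,k$ be positive integers with $m=2n$, $e=\gcd(n,d)=\gcd(m,d)$ and $1\le k\le \frac{n}{e}$, and let $C$ be the binary code described in the context. For even $r$ with $0\le r\le m/e$ and $\varepsilon\in\{1,-1\}$, let \[\alpha_{r,\varepsilon}=\#\{0\neq c\in C\mid {\rm DC}(c)=-1+\varepsilon 2^{m-\frac{er}{2}}\}.\] Then for each $j=0,1,\dots,k-1$ and each $\varepsilon=\pm1$, \[\alpha_{\frac{m}{e}-2j,\varepsilon}=\frac12\big(2^{m-2ej}+\varepsilon2^{\frac{m}{2}-ej}\big)\sum_{v=j}^{k-1}(-1)^{v-j}4^{e\binom{v-j}{2}}\binom{v}{j}_{4^e}\binom{\frac{m}{2e}}{v}_{4^e}\big(2^{n(2k-1-2v)+ev}-1\big).\]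
   Context: For $\vec a=(a_0,a_1,\dots,a_k)\in\mathbb{F}_{2^n}\times\mathbb{F}_{2^m}^k$ define $Q_{\vec a}:\mathbb{F}_{2^m}\to\mathbb{F}_{2^e}$ by \[Q_{\vec a}(x)={\rm Tr}_{\mathbb{F}_{2^n}/\mathbb{F}_{2^e}}\big(a_0x^{2^{nd/e}+1}\big)+\sum_{j=1}^{k-1}{\rm Tr}_{\mathbb{F}_{2^m}/\mathbb{F}_{2^e}}\big(a_jx^{2^{(\frac{n}{e}-j)d}+1}\big)+{\rm Tr}_{\mathbb{F}_{2^m}/\mathbb{F}_{2^e}}(a_kx).\] Here $x^{2^{nd/e}+1}\in\mathbb{F}_{2^n}$. Let $\pi$ be a primitive element of $\mathbb{F}_{2^m}$. Let $c_{\vec a}=(c_{\vec a,0},\dots,c_{\vec a,2^m-2})$ with $c_{\vec a,i}={\rm Tr}_{\mathbb{F}_{2^e}/\mathbb{F}_2}(Q_{\vec a}(\pi^{-i}))$, and let $C=\{c_{\vec a}\mid\vec a\in\mathbb{F}_{2^n}\times\mathbb{F}_{2^m}^k\}$. For $c=(c_0,\dots,c_{2^m-2})\in C$, ${\rm DC}(c)=\sum_{i=0}^{2^m-2}(-1)^{c_i}$. The symbol $\binom{a}{b}_q$ denotes the Gaussian binomial coefficient, and $\binom{a}{2}=a(a-1)/2$. *)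

theory Defs
  imports Complex_Main "HOL-Library.Cardinality"
begin

text \<open>Subfield of order q of a finite field (for q a power of the characteristic).\<close>
definition subF :: "nat \<Rightarrow> 'a::field set" where
  "subF q = {x. x ^ q = x}"

text \<open>Relative trace Tr from F_{2^s} down to F_{2^t} (t dividing s):
  y + y^(2^t) + ... + y^(2^(t*(s/t - 1))).\<close>
definition trace2 :: "nat \<Rightarrow> nat \<Rightarrow> 'a::field \<Rightarrow> 'a" where
  "trace2 s t y = (\<Sum>i<s div t. y ^ (2 ^ (t * i)))"

definition Qfun :: "nat \<Rightarrow> nat \<Rightarrow> nat \<Rightarrow> nat \<Rightarrow> nat \<Rightarrow> (nat \<Rightarrow> 'a::field) \<Rightarrow> 'a \<Rightarrow> 'a" where
  "Qfun m n d e k a x =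
     trace2 n e (a 0 * x ^ (2 ^ (n * d div e) + 1))
     + (\<Sum>j\<in>{1..k-1}. trace2 m e (a j * x ^ (2 ^ ((n div e - j) * d) + 1)))
     + trace2 m e (a k * x)"

definition codeword :: "nat \<Rightarrow> nat \<Rightarrow> nat \<Rightarrow> nat \<Rightarrow> nat \<Rightarrow> 'a::field \<Rightarrow> (nat \<Rightarrow> 'a) \<Rightarrow> bool list" where
  "codeword m n d e k \<pi> a =
     map (\<lambda>i. trace2 e 1 (Qfun m n d e k a (inverse (\<pi> ^ i))) \<noteq> 0) [0..<2 ^ m - 1]"

text \<open>The code C: a_0 ranges over F_{2^n}, a_1..a_k over F_{2^m} (the whole field).\<close>
definition code :: "nat \<Rightarrow> nat \<Rightarrow> nat \<Rightarrow> nat \<Rightarrow> nat \<Rightarrow> 'a::field \<Rightarrow> bool list set" where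
  "code m n d e k \<pi> = {codeword m n d e k \<pi> a | a. a 0 \<in> subF (2 ^ n)}"

definition DC :: "bool list \<Rightarrow> int" where
  "DC c = (\<Sum>b\<leftarrow>c. if b then -1 else 1)"

definition primitive_elem :: "'a::field \<Rightarrow> bool" where
  "primitive_elem \<pi> \<longleftrightarrow> (\<forall>x. x \<noteq> 0 \<longrightarrow> (\<exists>i::nat. x = \<pi> ^ i))"

text \<open>Gaussian binomial coefficient [a choose b]_q (it is 0 when b > a).\<close>
definition gauss_binom :: "real \<Rightarrow> nat \<Rightarrow> nat \<Rightarrow> real" where
  "gauss_binom q a b = (\<Prod>i<b. (q ^ (a - i) - 1) / (q ^ (i + 1) - 1))"

definition alpha :: "nat \<Rightarrow> nat \<Rightarrow> nat \<Rightarrow> nat \<Rightarrow> nat \<Rightarrow> 'a::field \<Rightarrow> nat \<Rightarrow> int \<Rightarrow> nat" where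
  "alpha m n d e k \<pi> r \<epsilon> =
     card {c \<in> code m n d e k \<pi>. c \<noteq> replicate (2 ^ m - 1) False
                         \<and> DC c = -1 + \<epsilon> * 2 ^ (m - e * r div 2)}"

end

theory Submission
  imports Defs "HOL-Library.FuncSet"
begin

text \<open>Put \<open>q = 2 ^ e\<close>, \<open>s = n / e\<close> and \<open>\<sigma> x = x ^ (2 ^ d)\<close>, a generator of the Galois group
  of the field over \<open>Fq\<close>. For fixed \<open>(a\<^sub>0, \<dots>, a\<^sub>k\<^sub>-\<^sub>1)\<close> the quadratic form has an alternating polar
  form \<open>Tr (x * L y)\<close> whose radical \<open>ker L\<close> has \<open>q ^ (2 * j)\<close> elements, and the first two moments over
  \<open>a\<^sub>k\<close> of the exponential sum determine how often it takes the values \<open>\<plusminus> 2 ^ (n + e * j)\<close>.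
  It remains to count the tuples with a radical of given size. For a nonzero tuple, \<open>L\<close> is a
  \<open>\<sigma>\<close>-polynomial with coefficients in a window of length \<open>2 * k - 1\<close>, so \<open>j < k\<close>. Dually, an
  element \<open>\<Sum> x\<^sub>i \<and> z\<^sub>i\<close> with fewer than \<open>k\<close> summands that is orthogonal to all the polar forms gives a
  map of small rank which is a \<open>\<sigma>\<close>-polynomial with a short window, hence vanishes. Character sums
  therefore yield the averages of \<open>\<Prod>i<u. q ^ (2 * j) - q ^ i\<close> for all \<open>u < k\<close>. These are converted
  to base \<open>q\<^sup>2\<close>, and \<open>q\<close>-binomial inversion gives the distribution of \<open>j\<close>.\<close>

section \<open>Additive maps and characters of finite groups\<close>

text \<open>Two counts have to match. There are \<open>k\<close> unknown frequencies, for
  \<open>j < k\<close>, and the duality argument supplies exactly the moments \<open>u < k\<close>: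
  a bivector with \<open>u\<close> summands has an image of dimension at most \<open>2 * u\<close>
  over \<open>Fq\<close>, hence a kernel too large for the window bound only while
  \<open>u < k\<close>. The factor \<open>q ^ (Suc u choose 2)\<close> in the moments counts
  symmetric \<open>u\<close> by \<open>u\<close> matrices over \<open>Fq\<close>. By Cartan's lemma
  these describe the relations \<open>\<Sum> x\<^sub>i \<and> z\<^sub>i = 0\<close> for independent
  \<open>x\<^sub>i\<close>. The obstacle is a mismatch of bases. The moments count lists independent
  over \<open>Fq\<close> and live in base \<open>q\<close>, while radicals have even dimension and
  the answer is in base \<open>q\<^sup>2\<close>. The conversion coefficients are never computed:
  one induction shows that some \<open>c\<close> satisfies two identities at once, one for the
  polynomials in \<open>z\<close> and one for the values that the moments assign to them.\<close>

lemma card_additive_kernel: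
  fixes f :: "'a::ab_group_add \<Rightarrow> 'b::ab_group_add"
  assumes fin: "finite G" and diff: "\<And>x y. x \<in> G \<Longrightarrow> y \<in> G \<Longrightarrow> x - y \<in> G"
    and add: "\<And>x y. x \<in> G \<Longrightarrow> y \<in> G \<Longrightarrow> x + y \<in> G"
    and f: "\<And>x y. x \<in> G \<Longrightarrow> y \<in> G \<Longrightarrow> f (x + y) = f x + f y"
  shows "card G = card (f ` G) * card {x \<in> G. f x = 0}"
proof -
  have fd: "f (x - y) = f x - f y" if "x \<in> G" "y \<in> G" for x y
    using f[of "x - y" y] that diff by (simp add: algebra_simps)
  have fib: "card {x \<in> G. f x = y} = card {x \<in> G. f x = 0}" if y: "y \<in> f ` G" for y
  proof -
    obtain x0 where x0: "x0 \<in> G" "y = f x0" using y by blast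
    have "bij_betw (\<lambda>x. x - x0) {x \<in> G. f x = y} {x \<in> G. f x = 0}"
      by (rule bij_betw_byWitness[where f' = "\<lambda>x. x + x0"]) (use x0 diff add fd f in auto)
    then show ?thesis by (rule bij_betw_same_card)
  qed
  have "card G = (\<Sum>x\<in>G. 1)" by simp
  also have "\<dots> = (\<Sum>y\<in>f ` G. \<Sum>x\<in>{x \<in> G. f x = y}. 1)"
    by (rule sum.image_gen[OF fin])
  also have "\<dots> = (\<Sum>y\<in>f ` G. card {x \<in> G. f x = 0})"
    by (rule sum.cong) (use fib in auto)
  finally show ?thesis by simp
qed

lemma sum_sign_character:
  fixes \<chi> :: "'a::ab_group_add \<Rightarrow> int"
  assumes fin: "finite G" and diff: "\<And>x y. x \<in> G \<Longrightarrow> y \<in> G \<Longrightarrow> x - y \<in> G"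
    and add: "\<And>x y. x \<in> G \<Longrightarrow> y \<in> G \<Longrightarrow> x + y \<in> G"
    and mult: "\<And>x y. x \<in> G \<Longrightarrow> y \<in> G \<Longrightarrow> \<chi> (x + y) = \<chi> x * \<chi> y"
  shows "(\<Sum>x\<in>G. \<chi> x) = (if \<forall>x\<in>G. \<chi> x = 1 then int (card G) else 0)"
proof (cases "\<forall>x\<in>G. \<chi> x = 1")
  case False
  then obtain g where g: "g \<in> G" "\<chi> g \<noteq> 1" by blast
  have "(\<Sum>x\<in>G. \<chi> x) = (\<Sum>x\<in>G. \<chi> (x + g))"
    by (rule sum.reindex_bij_witness[where j = "\<lambda>x. x - g" and i = "\<lambda>x. x + g"])
      (use g diff add in auto)
  also have "\<dots> = (\<Sum>x\<in>G. \<chi> x) * \<chi> g"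
    using g mult by (simp add: sum_distrib_right)
  finally have "(\<Sum>x\<in>G. \<chi> x) * (\<chi> g - 1) = 0" by (simp add: algebra_simps)
  with g False show ?thesis by auto
qed simp

lemma lists_length_Suc: "{xs. length xs = Suc u} = (\<lambda>(x, xs). x # xs) ` (UNIV \<times> {xs. length xs = u})"
  by (auto simp: length_Suc_conv image_iff)

lemma finite_lists_length_UNIV: "finite {xs :: 'a::finite list. length xs = u}"
  using finite_lists_length_eq[of "UNIV :: 'a set" u] by simp

lemma sum_lists_length_Suc:
  "(\<Sum>xs | length xs = Suc u. f xs) = (\<Sum>x\<in>UNIV. \<Sum>xs | length xs = u. f (x # xs))"
  unfolding lists_length_Suc
  by (subst sum.reindex) (auto simp: inj_on_def sum.cartesian_product case_prod_unfold)

section \<open>Gaussian binomial coefficients\<close>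

text \<open>Serves the induction of the base change: multiplying by a linear factor sends a basis
  element \<open>g u\<close> to \<open>g (Suc u) + h u * g u\<close>, and the left side collects the
  new coefficients.\<close>

lemma sum_shift_combine:
  fixes c g h :: "nat \<Rightarrow> real"
  shows "(\<Sum>u\<le>Suc v. ((if u = 0 then 0 else c (u - 1)) + (if u \<le> v then h u * c u else 0)) * g u)
    = (\<Sum>u\<le>v. c u * (g (Suc u) + h u * g u))"
proof -
  have "(\<Sum>u\<le>Suc v. (if u = 0 then 0 else c (u - 1)) * g u) = (\<Sum>u\<le>v. c u * g (Suc u))"
    by (subst sum.atMost_Suc_shift) simp
  moreover have "(\<Sum>u\<le>Suc v. (if u \<le> v then h u * c u else 0) * g u) = (\<Sum>u\<le>v. c u * (h u * g u))"
    by (simp add: ac_simps)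
  ultimately show ?thesis by (simp only: distrib_right distrib_left sum.distrib)
qed

text \<open>Multiplication by \<open>z\<close> on the basis \<open>\<Prod>i<u. z - q ^ i\<close> corresponds to the
  operator \<open>F \<mapsto> (F W - (1 - W) * (1 - q * W) * F (q\<^sup>2 * W)) / W\<close>, which involves only the
  square of the shift \<open>W \<mapsto> q * W\<close>. This is why moments in base \<open>q\<close> turn into moments in base
  \<open>q\<^sup>2\<close>.\<close>
lemma square_base_expansion:
  fixes q :: real
  assumes q: "q \<noteq> 0"
  shows "\<exists>c. (\<forall>z. (\<Prod>i<v. z - q ^ (2 * i)) = (\<Sum>u\<le>v. c u * (\<Prod>i<u. z - q ^ i))) \<and>
    (\<forall>W. W \<noteq> 0 \<longrightarrow> (\<Sum>u\<le>v. c u * (q ^ (Suc u choose 2) * (\<Prod>i<u. 1 - q ^ i * W)))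
        = q ^ v * (\<Prod>i<v. 1 - q ^ (2 * i) * W))"
proof (induction v)
  case 0
  show ?case by (rule exI[of _ "\<lambda>_. 1"]) (simp add: numeral_2_eq_2)
next
  case (Suc v)
  define p where "p z u = (\<Prod>i<u. z - q ^ i)" for z u
  define l where "l W u = q ^ (Suc u choose 2) * (\<Prod>i<u. 1 - q ^ i * W)" for W u
  define G where "G W v = q ^ v * (\<Prod>i<v. 1 - q ^ (2 * i) * W)" for W v
  obtain c where c: "\<And>z. (\<Prod>i<v. z - q ^ (2 * i)) = (\<Sum>u\<le>v. c u * p z u)"
    "\<And>W. W \<noteq> 0 \<Longrightarrow> (\<Sum>u\<le>v. c u * l W u) = G W v"
    using Suc by (auto simp: p_def l_def G_def)
  \<comment> \<open>From \<open>z - q ^ (2 * v) = (z - q ^ u) + (q ^ u - q ^ (2 * v))\<close>: the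
    first summand raises \<open>p z u\<close> to \<open>p z (Suc u)\<close>, the second rescales
    it.\<close>
  define c' where "c' u = (if u = 0 then 0 else c (u - 1)) + (if u \<le> v then (q ^ u - q ^ (2 * v)) * c u else 0)" for u
  have c': "(\<Sum>u\<le>Suc v. c' u * g u) = (\<Sum>u\<le>v. c u * (g (Suc u) + (q ^ u - q ^ (2 * v)) * g u))" for g :: "nat \<Rightarrow> real"
    unfolding c'_def by (rule sum_shift_combine)
  have 1: "(\<Prod>i<Suc v. z - q ^ (2 * i)) = (\<Sum>u\<le>Suc v. c' u * p z u)" for z
  proof -
    have "p z (Suc u) + (q ^ u - q ^ (2 * v)) * p z u = (z - q ^ (2 * v)) * p z u" for u
      by (simp add: p_def algebra_simps)
    then have "(\<Sum>u\<le>Suc v. c' u * p z u) = (z - q ^ (2 * v)) * (\<Sum>u\<le>v. c u * p z u)"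
      unfolding c' by (simp add: sum_distrib_left mult.left_commute)
    then show ?thesis by (simp add: c(1)[symmetric] mult.commute)
  qed
  have 2: "(\<Sum>u\<le>Suc v. c' u * l W u) = G W (Suc v)" if W: "W \<noteq> 0" for W
  proof -
    have lS: "l W (Suc u) = q ^ Suc u * (1 - q ^ u * W) * l W u" for W u
      by (simp add: l_def numeral_2_eq_2 power_add)
    have shift: "(1 - W) * (1 - q * W) * l (q\<^sup>2 * W) u = (1 - q ^ u * W) * (1 - q ^ Suc u * W) * l W u" for u
    proof -
      have "(\<Prod>i<Suc (Suc u). 1 - q ^ i * W) = (1 - W) * (1 - q * W) * (\<Prod>i<u. 1 - q ^ i * (q\<^sup>2 * W))"
        unfolding prod.lessThan_Suc_shift by (simp add: power2_eq_square ac_simps)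
      then show ?thesis by (simp add: l_def ac_simps)
    qed
    \<comment> \<open>The right side involves \<open>l\<close> at \<open>W\<close> and at
      \<open>q\<^sup>2 * W\<close> with multipliers free of \<open>u\<close>, so the induction
      hypothesis applies at both points.\<close>
    have "W * (l W (Suc u) + (q ^ u - q ^ (2 * v)) * l W u)
        = (1 - q ^ (2 * v) * W) * l W u - (1 - W) * (1 - q * W) * l (q\<^sup>2 * W) u" for u
      unfolding shift lS by (simp add: algebra_simps)
    then have "W * (c u * (l W (Suc u) + (q ^ u - q ^ (2 * v)) * l W u))
        = (1 - q ^ (2 * v) * W) * (c u * l W u) - (1 - W) * (1 - q * W) * (c u * l (q\<^sup>2 * W) u)" for u
      by (simp only: mult.left_commute[of W "c u"] mult.left_commute[of _ "c u"] right_diff_distrib)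
    then have "W * (\<Sum>u\<le>Suc v. c' u * l W u)
        = (\<Sum>u\<le>v. (1 - q ^ (2 * v) * W) * (c u * l W u) - (1 - W) * (1 - q * W) * (c u * l (q\<^sup>2 * W) u))"
      unfolding c' sum_distrib_left by (intro sum.cong refl)
    also have "\<dots> = (1 - q ^ (2 * v) * W) * G W v - (1 - W) * (1 - q * W) * G (q\<^sup>2 * W) v"
      using W q by (simp add: sum_subtractf sum_distrib_left[symmetric] c(2))
    also have "(1 - W) * (1 - q * W) * G (q\<^sup>2 * W) v = (1 - q * W) * ((1 - q ^ (2 * v) * W) * G W v)"
    proof -
      have "(\<Prod>i<Suc v. 1 - q ^ (2 * i) * W) = (1 - W) * (\<Prod>i<v. 1 - q ^ (2 * i) * (q\<^sup>2 * W))"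
        unfolding prod.lessThan_Suc_shift by (simp add: power2_eq_square power_add ac_simps)
      then show ?thesis by (simp add: G_def ac_simps)
    qed
    also have "(1 - q ^ (2 * v) * W) * G W v - (1 - q * W) * ((1 - q ^ (2 * v) * W) * G W v) = W * G W (Suc v)"
      by (simp add: G_def algebra_simps)
    finally show ?thesis using W by simp
  qed
  from 1 2 show ?case by (intro exI[of _ c']) (simp add: p_def l_def G_def)
qed

section \<open>Gaussian binomials and their inversion formula\<close>

definition gauss_fact :: "real \<Rightarrow> nat \<Rightarrow> real" where
  "gauss_fact b n = (\<Prod>i<n. b ^ (i + 1) - 1)"

lemma gauss_fact_nonzero: "1 < b \<Longrightarrow> gauss_fact b n \<noteq> 0"
  unfolding gauss_fact_def by (auto simp: power_eq_1_iff) (metis less_numeral_extra(4) one_less_power power_Suc zero_less_Suc)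

lemma prod_falling_gauss_fact:
  assumes "v \<le> a"
  shows "(\<Prod>i<v. b ^ (a - i) - 1) * gauss_fact b (a - v) = gauss_fact b a"
  using assms
proof (induction v)
  case (Suc v)
  have "gauss_fact b (a - v) = (b ^ (a - v) - 1) * gauss_fact b (a - Suc v)"
    using Suc.prems by (simp add: gauss_fact_def Suc_diff_Suc[symmetric] mult.commute del: diff_Suc_Suc)
  then show ?case using Suc by (simp add: mult.assoc)
qed simp

lemma gauss_binom_fact:
  assumes "1 < b" "v \<le> a"
  shows "gauss_binom b a v = gauss_fact b a / (gauss_fact b v * gauss_fact b (a - v))"
  using prod_falling_gauss_fact[OF assms(2), of b] gauss_fact_nonzero[OF assms(1)]
  by (simp add: gauss_binom_def prod_dividef gauss_fact_def[of b v, symmetric, simplified] field_simps)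

lemma gauss_binom_eq_0: "a < v \<Longrightarrow> gauss_binom b a v = 0"
  unfolding gauss_binom_def by (rule prod_zero) (auto intro!: bexI[of _ a])

lemma gauss_binom_0 [simp]: "gauss_binom b a 0 = 1"
  by (simp add: gauss_binom_def)

lemma gauss_binom_Suc_Suc:
  assumes "1 < b" "w \<le> n"
  shows "gauss_binom b (Suc n) (Suc w) = gauss_binom b n w + b ^ (w + 1) * gauss_binom b n (w + 1)"
proof (cases "w = n")
  case True
  then show ?thesis using assms gauss_fact_nonzero[OF assms(1)]
    by (simp add: gauss_binom_fact gauss_binom_eq_0)
next
  case False
  then obtain r where n: "n = Suc (w + r)" using assms(2) by (metis le_less less_iff_Suc_add)
  have S: "gauss_fact b (Suc i) = (b ^ Suc i - 1) * gauss_fact b i" for i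
    by (simp add: gauss_fact_def mult.commute)
  define x y G fw fr where defs: "x = b ^ Suc w" "y = b ^ Suc r" "G = gauss_fact b n"
    "fw = gauss_fact b w" "fr = gauss_fact b r"
  \<comment> \<open>Once the common denominator \<open>D\<close> is cleared, the rule is
    \<open>(x - 1) + x * (y - 1) = x * y - 1\<close>, multiplied by \<open>G\<close>.\<close>
  define D where "D = (x - 1) * fw * ((y - 1) * fr)"
  have ne: "x - 1 \<noteq> 0" "y - 1 \<noteq> 0" "fw \<noteq> 0" "fr \<noteq> 0"
    using one_less_power[OF assms(1), of "Suc _"] gauss_fact_nonzero[OF assms(1)] by (simp_all add: defs less_le)
  then have D: "D \<noteq> 0" by (simp add: D_def)
  have idx: "Suc n - Suc w = Suc r" "n - w = Suc r" "n - Suc w = r" by (simp_all add: n)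
  have le: "Suc w \<le> Suc n" "w \<le> n" "Suc w \<le> n" by (simp_all add: n)
  have xy: "b ^ Suc n = x * y" by (simp add: n defs power_add)
  have f: "gauss_fact b (Suc w) = (x - 1) * fw" "gauss_fact b (Suc r) = (y - 1) * fr"
    "gauss_fact b (Suc n) = (x * y - 1) * G"
    using S[of w] S[of r] S[of n] by (simp_all only: defs xy[unfolded defs])
  have X: "gauss_binom b (Suc n) (Suc w) * D = (x * y - 1) * G"
    unfolding gauss_binom_fact[OF assms(1) le(1)] idx f D_def using ne by simp
  have Y: "gauss_binom b n w * D = (x - 1) * G"
    unfolding gauss_binom_fact[OF assms(1) le(2)] idx f D_def defs(3,4)[symmetric] using ne by simp
  have Z: "gauss_binom b n (Suc w) * D = (y - 1) * G"
    unfolding gauss_binom_fact[OF assms(1) le(3)] idx f D_def defs(3,5)[symmetric] using ne by simp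
  have "(gauss_binom b n w + x * gauss_binom b n (Suc w)) * D = (x - 1) * G + x * ((y - 1) * G)"
    by (simp only: distrib_right mult.assoc Y Z)
  also have "\<dots> = gauss_binom b (Suc n) (Suc w) * D" unfolding X by (simp add: algebra_simps)
  finally show ?thesis using D by (simp add: defs(1))
qed

text \<open>The q-binomial theorem at the point where its product contains the factor
  \<open>1 - 1\<close>; here the q-Pascal rule makes the terms telescope.\<close>

lemma gauss_binom_alternating_sum:
  assumes b: "1 < b"
  shows "(\<Sum>w\<le>n. (-1) ^ w * b ^ (w choose 2) * gauss_binom b n w) = (if n = 0 then 1 else 0)"
proof (cases n)
  case 0
  then show ?thesis by (simp add: numeral_2_eq_2)
next
  case (Suc n')
  let ?s = "\<lambda>w. (-1) ^ w * b ^ (Suc w choose 2) * gauss_binom b n' w"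
  have "(\<Sum>w\<le>n. (-1) ^ w * b ^ (w choose 2) * gauss_binom b n w)
     = 1 + (\<Sum>w\<le>n'. (-1) ^ Suc w * b ^ (Suc w choose 2) * gauss_binom b (Suc n') (Suc w))"
    unfolding Suc by (subst sum.atMost_Suc_shift) (simp add: numeral_2_eq_2)
  also have "(\<Sum>w\<le>n'. (-1) ^ Suc w * b ^ (Suc w choose 2) * gauss_binom b (Suc n') (Suc w))
     = (\<Sum>w\<le>n'. ?s (Suc w) - ?s w)"
  proof (rule sum.cong)
    fix w assume "w \<in> {..n'}"
    then show "(-1) ^ Suc w * b ^ (Suc w choose 2) * gauss_binom b (Suc n') (Suc w) = ?s (Suc w) - ?s w"
      using gauss_binom_Suc_Suc[OF b, of w n'] by (simp add: numeral_2_eq_2 power_add algebra_simps)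
  qed simp
  also have "\<dots> = ?s (Suc n') - ?s 0"
    using sum_lessThan_telescope[of ?s "Suc n'"] by (simp add: lessThan_Suc_atMost)
  also have "\<dots> = - 1" by (simp add: gauss_binom_eq_0 numeral_2_eq_2)
  finally show ?thesis using Suc by simp
qed

text \<open>The binomials \<open>v\<close> over \<open>j\<close> and \<open>i\<close> over
  \<open>v\<close> multiply to \<open>i\<close> over \<open>j\<close> times \<open>i - j\<close>
  over \<open>v - j\<close>; what remains is an alternating sum for \<open>i - j\<close>.\<close>

lemma gauss_binom_orthogonality:
  assumes b: "1 < b" and i: "i < k" and j: "j < k"
  shows "(\<Sum>v = j..k - 1. (-1) ^ (v - j) * b ^ ((v - j) choose 2) * gauss_binom b v j * gauss_binom b i v)
    = (if i = j then 1 else 0)"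
proof (cases "j \<le> i")
  case False
  then have "gauss_binom b i v = 0" if "v \<in> {j..k-1}" for v
    using that by (intro gauss_binom_eq_0) auto
  with False show ?thesis by (auto intro!: sum.neutral)
next
  case True
  have "(\<Sum>v = j..k - 1. (-1) ^ (v - j) * b ^ ((v - j) choose 2) * gauss_binom b v j * gauss_binom b i v)
     = (\<Sum>v = j..i. (-1) ^ (v - j) * b ^ ((v - j) choose 2) * gauss_binom b v j * gauss_binom b i v)"
    using i by (intro sum.mono_neutral_right) (auto simp: gauss_binom_eq_0)
  also have "\<dots> = (\<Sum>w\<le>i - j. gauss_binom b i j * ((-1) ^ w * b ^ (w choose 2) * gauss_binom b (i - j) w))"
  proof (rule sum.reindex_bij_witness[where i = "\<lambda>w. w + j" and j = "\<lambda>v. v - j"])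
    fix v assume v: "v \<in> {j..i}"
    have "i - j - (v - j) = i - v" using v by auto
    then have "gauss_binom b v j * gauss_binom b i v = gauss_binom b i j * gauss_binom b (i - j) (v - j)"
      using v True gauss_fact_nonzero[OF b] gauss_binom_fact[OF b, of "v - j" "i - j"]
      by (simp add: gauss_binom_fact[OF b] diff_le_mono field_simps)
    then show "gauss_binom b i j * ((-1) ^ (v - j) * b ^ ((v - j) choose 2) * gauss_binom b (i - j) (v - j))
        = (-1) ^ (v - j) * b ^ ((v - j) choose 2) * gauss_binom b v j * gauss_binom b i v"
      by (simp add: mult.left_commute mult.assoc)
  qed (use True in auto)
  also have "\<dots> = gauss_binom b i j * (if i - j = 0 then 1 else 0)"
    by (simp only: sum_distrib_left[symmetric] gauss_binom_alternating_sum[OF b])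
  also have "\<dots> = (if i = j then 1 else 0)"
    using True gauss_fact_nonzero[OF b] by (auto simp: gauss_binom_fact[OF b]) (simp add: gauss_fact_def)
  finally show ?thesis .
qed

lemma gauss_binom_inversion:
  assumes b: "1 < b" and g: "\<And>v. v < k \<Longrightarrow> (\<Sum>i<k. A i * gauss_binom b i v) = g v" and j: "j < k"
  shows "A j = (\<Sum>v = j..k - 1. (-1) ^ (v - j) * b ^ ((v - j) choose 2) * gauss_binom b v j * g v)"
proof -
  have "(\<Sum>v = j..k - 1. (-1) ^ (v - j) * b ^ ((v - j) choose 2) * gauss_binom b v j * g v)
     = (\<Sum>v = j..k - 1. \<Sum>i<k. A i * ((-1) ^ (v - j) * b ^ ((v - j) choose 2) * gauss_binom b v j * gauss_binom b i v))"
  proof (rule sum.cong[OF refl])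
    fix v assume "v \<in> {j..k - 1}"
    then have "v < k" using j by auto
    show "(-1) ^ (v - j) * b ^ ((v - j) choose 2) * gauss_binom b v j * g v
      = (\<Sum>i<k. A i * ((-1) ^ (v - j) * b ^ ((v - j) choose 2) * gauss_binom b v j * gauss_binom b i v))"
      unfolding g[OF \<open>v < k\<close>, symmetric] sum_distrib_left by (simp only: mult.left_commute[of _ "A _"])
  qed
  also have "\<dots> = (\<Sum>i<k. A i * (\<Sum>v = j..k - 1. (-1) ^ (v - j) * b ^ ((v - j) choose 2) * gauss_binom b v j * gauss_binom b i v))"
    by (subst sum.swap) (simp only: sum_distrib_left)
  also have "\<dots> = (\<Sum>i<k. if i = j then A i else 0)"
  proof (rule sum.cong[OF refl])
    fix i assume "i \<in> {..<k}"
    then have "i < k" by simp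
    then show "A i * (\<Sum>v = j..k - 1. (-1) ^ (v - j) * b ^ ((v - j) choose 2) * gauss_binom b v j * gauss_binom b i v)
        = (if i = j then A i else 0)"
      by (simp only: gauss_binom_orthogonality[OF b _ j] mult_1_right mult_zero_right if_distrib[of "(*) _"])
  qed
  also have "\<dots> = A j" using j by simp
  finally show ?thesis by simp
qed

text \<open>For a prime power \<open>b\<close>, independent \<open>v\<close>-lists in dimension
  \<open>a\<close> are the \<open>v\<close>-dimensional subspaces, each with its ordered bases. For
  \<open>a < v\<close> both sides contain a zero factor.\<close>

lemma gauss_binom_prod:
  assumes b: "1 < b"
  shows "gauss_binom b a v * (\<Prod>i<v. b ^ v - b ^ i) = (\<Prod>i<v. b ^ a - b ^ i)"
proof (cases "v \<le> a")
  case False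
  then have "(\<Prod>i<v. b ^ a - b ^ i) = 0" by (intro prod_zero) (auto intro!: bexI[of _ a])
  then show ?thesis using False by (simp add: gauss_binom_eq_0)
next
  case True
  have fac: "(\<Prod>i<v. b ^ c - b ^ i) = (\<Prod>i<v. b ^ i) * (\<Prod>i<v. b ^ (c - i) - 1)" if "v \<le> c" for c
  proof -
    have "b ^ c - b ^ i = b ^ i * (b ^ (c - i) - 1)" if "i < v" for i
      using that \<open>v \<le> c\<close> by (simp add: algebra_simps power_add[symmetric])
    then show ?thesis by (simp add: prod.distrib[symmetric])
  qed
  have v: "(\<Prod>i<v. b ^ (v - i) - 1) = gauss_fact b v"
    using prod_falling_gauss_fact[of v v b] by (simp add: gauss_fact_def)
  have "gauss_binom b a v * gauss_fact b v = (\<Prod>i<v. b ^ (a - i) - 1)"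
    using prod_falling_gauss_fact[OF True, of b] gauss_fact_nonzero[OF b]
    by (simp add: gauss_binom_fact[OF b True] field_simps)
  then show ?thesis by (simp add: fac[OF True] fac[OF order_refl] v mult.left_commute)
qed

section \<open>Finite fields of characteristic two\<close>

locale binary_field =
  fixes F :: "'a::{field,finite} itself" and m :: nat
  assumes card_field: "CARD('a) = 2 ^ m" and m_pos: "0 < m"
begin

lemma two_eq_0: "(2::'a) = 0"
proof -
  have "(\<Sum>x\<in>(UNIV::'a set). x) = (\<Sum>x\<in>UNIV. x + 1)"
    by (rule sum.reindex_bij_witness[where j = "\<lambda>x. x - 1" and i = "\<lambda>x. x + 1"]) auto
  also have "\<dots> = (\<Sum>x\<in>(UNIV::'a set). x) + of_nat CARD('a)"
    by (simp add: sum.distrib)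
  finally have "(of_nat (2 ^ m) :: 'a) = 0" using card_field by simp
  then show ?thesis using m_pos by simp
qed

lemma add_self [simp]: "x + x = (0::'a)"
  using two_eq_0 by (metis mult_2 mult_zero_left)

lemma add_self_left [simp]: "x + (x + y) = (y::'a)"
  by (simp add: add.assoc[symmetric])

lemma uminus_eq [simp]: "- x = (x::'a)"
  by (rule minus_unique) simp

text \<open>Together with \<open>uminus_eq\<close> this normalises differences to sums; the rule is
  removed where a genuine difference has to survive.\<close>

lemma diff_eq_add [simp]: "x - y = x + (y::'a)"
  using diff_conv_add_uminus by simp

lemma add_eq_0: "x + y = 0 \<longleftrightarrow> x = (y::'a)"
  by (metis add_self add_self_left add.right_neutral)

lemma frob_add: "(x + y) ^ (2 ^ t) = x ^ (2 ^ t) + (y::'a) ^ (2 ^ t)"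
proof (induction t)
  case (Suc t)
  have "(x + y) ^ (2 ^ Suc t) = ((x + y) ^ (2 ^ t))\<^sup>2"
    by (simp add: power_mult[symmetric] mult.commute)
  also have "\<dots> = (x ^ (2 ^ t))\<^sup>2 + (y ^ (2 ^ t))\<^sup>2"
    by (simp add: Suc power2_sum two_eq_0)
  finally show ?case by (simp add: power_mult[symmetric] mult.commute)
qed simp

lemma frob_sum: "(\<Sum>i\<in>A. f i) ^ (2 ^ t) = (\<Sum>i\<in>A. (f i :: 'a) ^ (2 ^ t))"
  by (induction A rule: infinite_finite_induct) (simp_all add: frob_add)

lemma power_card_minus_1: "(x::'a) \<noteq> 0 \<Longrightarrow> x ^ (2 ^ m - 1) = 1"
proof -
  assume x: "x \<noteq> 0"
  have "(\<Prod>y\<in>-{0::'a}. y) = (\<Prod>y\<in>-{0::'a}. x * y)"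
    by (rule prod.reindex_bij_witness[where j = "\<lambda>y. y / x" and i = "\<lambda>y. x * y"])
      (use x in auto)
  also have "\<dots> = x ^ card (-{0::'a}) * (\<Prod>y\<in>-{0::'a}. y)"
    by (simp add: prod.distrib)
  finally have "x ^ card (-{0::'a}) = 1" by simp
  then show ?thesis by (simp add: card_field Compl_eq_Diff_UNIV card_Diff_singleton)
qed

lemma power_card [simp]: "(x::'a) ^ (2 ^ m) = x"
proof (cases "x = 0")
  case False
  then have "x ^ (2 ^ m) = x ^ (2 ^ m - 1) * x"
    by (metis power_Suc2 Suc_diff_1 zero_less_numeral zero_less_power)
  with False show ?thesis using power_card_minus_1[of x] by simp
qed (use m_pos in simp)

lemma frob_frob: "((x::'a) ^ (2 ^ i)) ^ (2 ^ j) = x ^ (2 ^ (i + j))"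
  by (simp add: power_mult[symmetric] power_add)

lemma frob_fixed_mult: "(x::'a) ^ (2 ^ i) = x \<Longrightarrow> x ^ (2 ^ (i * j)) = x"
proof (induction j)
  case (Suc j)
  have "x ^ (2 ^ (i * Suc j)) = (x ^ (2 ^ i)) ^ (2 ^ (i * j))"
    by (simp only: frob_frob) simp
  then show ?case using Suc by simp
qed simp

lemma frob_period: "(x::'a) ^ (2 ^ (i + m * j)) = x ^ (2 ^ i)"
  by (metis frob_fixed_mult frob_frob power_card)

lemma frob_inj: "(x::'a) ^ (2 ^ t) = y ^ (2 ^ t) \<longleftrightarrow> x = y"
proof
  assume "x ^ (2 ^ t) = y ^ (2 ^ t)"
  then have "(x + y) ^ (2 ^ t) = 0" by (simp add: frob_add)
  then show "x = y" by (simp add: add_eq_0)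
qed simp

lemma subF_add: "x \<in> subF (2 ^ t) \<Longrightarrow> y \<in> subF (2 ^ t) \<Longrightarrow> x + y \<in> (subF (2 ^ t) :: 'a set)"
  by (simp add: subF_def frob_add)

lemma subF_mult: "x \<in> subF t \<Longrightarrow> y \<in> subF t \<Longrightarrow> x * y \<in> (subF t :: 'a set)"
  by (simp add: subF_def power_mult_distrib)

lemma subF_inverse: "x \<in> subF t \<Longrightarrow> inverse x \<in> (subF t :: 'a set)"
  by (simp add: subF_def power_inverse)

lemma subF_0 [simp]: "(0::'a) \<in> subF (2 ^ t)"
  by (simp add: subF_def)

lemma subF_sum: "(\<And>i. i \<in> A \<Longrightarrow> f i \<in> subF (2 ^ t)) \<Longrightarrow> (\<Sum>i\<in>A. f i) \<in> (subF (2 ^ t) :: 'a set)"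
  by (induction A rule: infinite_finite_induct) (auto simp: subF_add)

lemma card_subF_pos: "0 < card (subF (2 ^ t) :: 'a set)"
  by (metis subF_0 card_gt_0_iff empty_iff finite)

text \<open>A root \<open>x0\<close> allows one to factor out \<open>w \<mapsto> w ^ (2 ^ d) - w\<close> after the substitution
  \<open>x = x0 * w\<close>, which lowers the length by one and has the kernel \<open>subF (2 ^ d)\<close>.\<close>
lemma card_linearized_roots:
  fixes c :: "nat \<Rightarrow> 'a"
  assumes "\<exists>i\<le>t. c i \<noteq> 0"
  shows "card {x. (\<Sum>i\<le>t. c i * x ^ (2 ^ (d * i))) = 0} \<le> card (subF (2 ^ d) :: 'a set) ^ t"
  using assms
proof (induction t arbitrary: c)
  case 0
  then have "{x. (\<Sum>i\<le>0. c i * x ^ (2 ^ (d * i))) = 0} = {0}" by auto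
  then show ?case by simp
next
  case (Suc t)
  let ?R = "{x. (\<Sum>i\<le>Suc t. c i * x ^ (2 ^ (d * i))) = 0}"
  show ?case
  proof (cases "?R \<subseteq> {0}")
    case True
    then have "card ?R \<le> card {0::'a}" by (intro card_mono) auto
    also have "\<dots> \<le> card (subF (2 ^ d) :: 'a set) ^ Suc t"
      using card_subF_pos[of d] by (simp add: Suc_leI del: power_Suc)
    finally show ?thesis .
  next
    case False
    then obtain x0 where x0: "x0 \<noteq> 0" "x0 \<in> ?R" by blast
    define c' where "c' i = c i * x0 ^ (2 ^ (d * i))" for i
    \<comment> \<open>Abel summation: \<open>c'\<close> has total zero, so inserting the expansion
      \<open>tel\<close> kills the term linear in \<open>w\<close> and gives each power of
      \<open>h w\<close> a tail sum of \<open>c'\<close> as its coefficient.\<close>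
    define g where "g i = (\<Sum>l\<in>{i<..Suc t}. c' l)" for i
    define h where "h w = w ^ (2 ^ d) + w" for w :: 'a
    have c'0: "(\<Sum>l\<le>Suc t. c' l) = 0" using x0(2) by (simp add: c'_def)
    have h_add: "h (x + y) = h x + h y" for x y
      by (simp add: h_def frob_add algebra_simps)
    have tel: "w ^ (2 ^ (d * l)) = w + (\<Sum>i<l. (h w) ^ (2 ^ (d * i)))" for w l
    proof (induction l)
      case (Suc l)
      have "(h w) ^ (2 ^ (d * l)) = w ^ (2 ^ (d + d * l)) + w ^ (2 ^ (d * l))"
        by (simp add: h_def frob_add frob_frob)
      then show ?case using Suc by (simp add: algebra_simps)
    qed simp
    have key: "(\<Sum>l\<le>Suc t. c' l * w ^ (2 ^ (d * l))) = (\<Sum>i\<le>t. g i * (h w) ^ (2 ^ (d * i)))" for w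
    proof -
      have "(\<Sum>l\<le>Suc t. c' l * w ^ (2 ^ (d * l)))
          = (\<Sum>l\<le>Suc t. c' l * w) + (\<Sum>l\<le>Suc t. \<Sum>i<l. c' l * (h w) ^ (2 ^ (d * i)))"
        by (subst tel) (simp add: algebra_simps sum.distrib sum_distrib_left del: sum.atMost_Suc)
      also have "(\<Sum>l\<le>Suc t. c' l * w) = 0"
        using c'0 by (simp add: sum_distrib_right[symmetric] del: sum.atMost_Suc)
      also have "(\<Sum>l\<le>Suc t. \<Sum>i<l. c' l * (h w) ^ (2 ^ (d * i)))
          = (\<Sum>l\<le>Suc t. \<Sum>i\<in>{i\<in>{..t}. i < l}. c' l * (h w) ^ (2 ^ (d * i)))"
        by (intro sum.cong) auto
      also have "\<dots> = (\<Sum>i\<le>t. \<Sum>l\<in>{l\<in>{..Suc t}. i < l}. c' l * (h w) ^ (2 ^ (d * i)))"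
        by (rule sum.swap_restrict) auto
      also have "\<dots> = (\<Sum>i\<le>t. g i * (h w) ^ (2 ^ (d * i)))"
        unfolding g_def sum_distrib_right by (intro sum.cong) auto
      finally show ?thesis by simp
    qed
    have "\<exists>i\<le>t. g i \<noteq> 0"
    proof (rule ccontr)
      assume "\<not> ?thesis"
      then have g0: "g i = 0" if "i \<le> t" for i using that by blast
      have gS: "g (Suc t) = 0" by (simp add: g_def)
      have step: "g i = c' (Suc i) + g (Suc i)" if "i \<le> t" for i
      proof -
        have "{i<..Suc t} = insert (Suc i) {Suc i<..Suc t}" using that by auto
        then show ?thesis by (simp add: g_def)
      qed
      have pos: "c' (Suc i) = 0" if "i \<le> t" for i
        using step[OF that] g0[of i] g0[of "Suc i"] gS that by (cases "i = t") auto
      have "(\<Sum>l\<le>Suc t. c' l) = c' 0 + (\<Sum>l\<le>t. c' (Suc l))" by (rule sum.atMost_Suc_shift)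
      then have "c' 0 = 0" using c'0 pos by simp
      with pos have "c' i = 0" if "i \<le> Suc t" for i
        using that by (cases i) auto
      then show False using Suc.prems x0 by (auto simp: c'_def)
    qed
    note IH = Suc.IH[OF this]
    let ?W = "{w. (\<Sum>l\<le>Suc t. c' l * w ^ (2 ^ (d * l))) = 0}"
    have "bij_betw (\<lambda>w. x0 * w) ?W ?R"
    proof (rule bij_betw_byWitness[where f' = "\<lambda>x. x / x0"])
      show "(\<lambda>w. x0 * w) ` ?W \<subseteq> ?R" "(\<lambda>x. x / x0) ` ?R \<subseteq> ?W"
        using x0(1) by (auto simp: c'_def power_mult_distrib power_divide algebra_simps)
    qed (use x0 in auto)
    then have "card ?R = card ?W" by (simp add: bij_betw_same_card)
    also have "\<dots> = card (h ` ?W) * card {w\<in>?W. h w = 0}"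
    proof (rule card_additive_kernel)
      fix x y assume "x \<in> ?W" "y \<in> ?W"
      then show "x + y \<in> ?W"
        unfolding mem_Collect_eq frob_add distrib_left sum.distrib by simp
      then show "x - y \<in> ?W" by simp
    qed (auto simp: h_add)
    also have "\<dots> \<le> card {x. (\<Sum>i\<le>t. g i * x ^ (2 ^ (d * i))) = 0} * card (subF (2 ^ d) :: 'a set)"
      by (intro mult_mono card_mono) (auto simp: key h_def subF_def add_eq_0 simp del: sum.atMost_Suc)
    also have "\<dots> \<le> card (subF (2 ^ d) :: 'a set) ^ Suc t" using IH by simp
    finally show ?thesis .
  qed
qed

lemma subF_2: "subF (2 ^ 1) = {0, 1 :: 'a}"
proof -
  have "x = 0 \<or> x = 1" if "x\<^sup>2 = x" for x :: 'a
  proof -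
    have "x * (x - 1) = 0" using that by (simp add: algebra_simps power2_eq_square del: diff_eq_add)
    then show ?thesis by (auto simp del: diff_eq_add)
  qed
  then show ?thesis by (auto simp: subF_def)
qed

lemma card_subF_2: "card (subF (2 ^ 1) :: 'a set) = 2"
  unfolding subF_2 by simp

text \<open>From above: the subfield is the root set of a linearized polynomial of length
  \<open>t\<close> in powers of squaring. From below: with \<open>m = t * r\<close>, the trace
  \<open>T\<close> maps into the subfield and its kernel has at most the \<open>(r - 1)\<close>-th
  power of the subfield's size.\<close>

lemma card_subF: assumes "t dvd m" shows "card (subF (2 ^ t) :: 'a set) = 2 ^ t"
proof (rule antisym)
  have t: "0 < t" using assms m_pos by (metis dvd_0_left_iff gr0I less_not_refl2)
  let ?c = "\<lambda>i. if i = 0 \<or> i = t then 1 else 0 :: 'a"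
  have "(\<Sum>i\<le>t. ?c i * x ^ (2 ^ (1 * i))) = x + x ^ (2 ^ t)" for x :: 'a
  proof -
    have "(\<Sum>i\<le>t. ?c i * x ^ (2 ^ (1 * i))) = (\<Sum>i\<in>{0, t}. x ^ (2 ^ i))"
      by (rule sum.mono_neutral_cong_right) auto
    then show ?thesis using t by simp
  qed
  then have "{x. (\<Sum>i\<le>t. ?c i * x ^ (2 ^ (1 * i))) = 0} = subF (2 ^ t)"
    by (auto simp: subF_def add_eq_0)
  then show "card (subF (2 ^ t) :: 'a set) \<le> 2 ^ t"
    using card_linearized_roots[of t ?c 1] unfolding card_subF_2 by fastforce
  obtain r where r: "m = t * r" using assms by blast
  have r0: "0 < r" using r m_pos by (cases r) auto
  define T where "T x = (\<Sum>i<r. (x::'a) ^ (2 ^ (t * i)))" for x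
  have T_add: "T (x + y) = T x + T y" for x y by (simp add: T_def frob_add sum.distrib)
  have "T x ^ (2 ^ t) = T x" for x
  proof -
    have "T x ^ (2 ^ t) = (\<Sum>i<r. x ^ (2 ^ (t * Suc i)))"
      by (simp add: T_def frob_sum frob_frob add.commute)
    also have "\<dots> + x = (\<Sum>i<Suc r. x ^ (2 ^ (t * i)))"
      unfolding sum.lessThan_Suc_shift by (simp add: add.commute)
    also have "\<dots> = T x + x" using r power_card[of x] by (simp add: T_def)
    finally show ?thesis by simp
  qed
  then have im: "T ` UNIV \<subseteq> subF (2 ^ t)" by (auto simp: subF_def)
  have "(2::nat) ^ m = card (T ` UNIV) * card {x\<in>UNIV. T x = 0}"
    unfolding card_field[symmetric] by (rule card_additive_kernel) (auto simp: T_add)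
  also have "\<dots> \<le> card (subF (2 ^ t) :: 'a set) * card (subF (2 ^ t) :: 'a set) ^ (r - 1)"
  proof (rule mult_mono)
    show "card {x\<in>UNIV. T x = 0} \<le> card (subF (2 ^ t) :: 'a set) ^ (r - 1)"
      using card_linearized_roots[of "r - 1" "\<lambda>_. 1" t] r0
      by (fastforce simp: T_def lessThan_Suc_atMost[symmetric])
  qed (use im in \<open>auto intro: card_mono\<close>)
  also have "\<dots> = card (subF (2 ^ t) :: 'a set) ^ r"
    using r0 by (metis power_Suc Suc_diff_1)
  finally have "(2 ^ t) ^ r \<le> card (subF (2 ^ t) :: 'a set) ^ r" by (simp add: r power_mult)
  then show "2 ^ t \<le> card (subF (2 ^ t) :: 'a set)"
    using r0 by (simp add: power_mono_iff)
qed

section \<open>The absolute trace and its additive character\<close>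

definition tr :: "'a \<Rightarrow> 'a" where
  "tr x = (\<Sum>i<m. x ^ (2 ^ i))"

text \<open>A sign on the two-element subfield. The value elsewhere is a default, so
  multiplicativity is claimed only on that subfield.\<close>

definition sgn2 :: "'a \<Rightarrow> int" where
  "sgn2 x = (if x = 0 then 1 else -1)"

definition \<psi> :: "'a \<Rightarrow> int" where
  "\<psi> x = sgn2 (tr x)"

lemma tr_add: "tr (x + y) = tr x + tr y"
  by (simp add: tr_def frob_add sum.distrib)

lemma tr_0 [simp]: "tr 0 = 0"
  using tr_add[of 0 0] by simp

lemma tr_sum: "tr (\<Sum>i\<in>A. f i) = (\<Sum>i\<in>A. tr (f i))"
  by (induction A rule: infinite_finite_induct) (auto simp: tr_add)

lemma tr_frob: "tr (x ^ (2 ^ t)) = tr x"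
proof (induction t)
  case (Suc t)
  have sq: "tr (y\<^sup>2) = tr y" for y
  proof -
    have "tr (y\<^sup>2) + y = (\<Sum>i<Suc m. y ^ (2 ^ i))"
      unfolding sum.lessThan_Suc_shift by (simp add: tr_def power_mult[symmetric] add.commute)
    also have "\<dots> = tr y + y" by (simp add: tr_def)
    finally show ?thesis by simp
  qed
  have "x ^ (2 ^ Suc t) = (x ^ (2 ^ t))\<^sup>2" by (simp add: power_mult[symmetric] mult.commute)
  then show ?case using sq Suc by metis
qed simp

lemma tr_subF: "tr x \<in> subF (2 ^ 1)"
  using tr_frob[of x 1] by (simp add: subF_def tr_def frob_sum[of _ _ 1, simplified] power_mult[symmetric] mult.commute)

lemma sgn2_add: "x \<in> subF (2 ^ 1) \<Longrightarrow> y \<in> subF (2 ^ 1) \<Longrightarrow> sgn2 (x + y) = sgn2 x * sgn2 y"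
  unfolding subF_2 by (auto simp: sgn2_def)

lemma psi_add: "\<psi> (x + y) = \<psi> x * \<psi> y"
  unfolding \<psi>_def tr_add using tr_subF by (intro sgn2_add)

lemma psi_0 [simp]: "\<psi> 0 = 1"
  by (simp add: \<psi>_def sgn2_def)

lemma psi_sum: "finite A \<Longrightarrow> \<psi> (\<Sum>i\<in>A. f i) = (\<Prod>i\<in>A. \<psi> (f i))"
  by (induction A rule: finite_induct) (auto simp: psi_add)

lemma psi_eq_1: "\<psi> x = 1 \<longleftrightarrow> tr x = 0"
  by (simp add: \<psi>_def sgn2_def)

text \<open>A zero trace would be a linearized polynomial of length \<open>m - 1\<close> with
  \<open>2 ^ m\<close> roots.\<close>

lemma tr_nontrivial: "\<exists>x. tr x \<noteq> 0"
proof (rule ccontr)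
  assume "\<not> ?thesis"
  then have "{x. (\<Sum>i\<le>m - 1. 1 * x ^ (2 ^ (1 * i))) = 0} = (UNIV :: 'a set)"
    using m_pos by (auto simp: tr_def lessThan_Suc_atMost[symmetric])
  then have "CARD('a) \<le> 2 ^ (m - 1)"
    using card_linearized_roots[of "m - 1" "\<lambda>_. 1" 1] unfolding card_subF_2 by fastforce
  also have "\<dots> < 2 ^ m" using m_pos by simp
  finally show False using card_field by simp
qed

lemma tr_nondegenerate: "(\<And>y. tr (x * y) = 0) \<Longrightarrow> x = 0"
  using tr_nontrivial by (metis nonzero_mult_div_cancel_left times_divide_eq_right)

lemma sum_psi: "(\<Sum>y\<in>UNIV. \<psi> (x * y)) = (if x = 0 then 2 ^ m else 0)"
  using sum_sign_character[of UNIV "\<lambda>y. \<psi> (x * y)"] tr_nondegenerate[of x]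
  by (auto simp: psi_add distrib_left card_field psi_eq_1)

lemma sum_psi_right: "(\<Sum>y\<in>UNIV. \<psi> (y * x)) = (if x = 0 then 2 ^ m else 0)"
  using sum_psi[of x] by (simp add: mult.commute)

end

section \<open>Linearized polynomials and alternating bivectors\<close>

locale norm_form_code = binary_field F m for F :: "'a::{field,finite} itself" and m +
  fixes n d e k s d' :: nat
  assumes m_eq: "m = e * (2 * s)" and n_eq: "n = e * s" and d_eq: "d = e * d'"
    and odd_d': "odd d'" and coprime_d': "coprime d' (2 * s)"
    and e_pos: "0 < e" and k_pos: "0 < k" and k_le: "k \<le> s"
begin

abbreviation Fq :: "'a set" where "Fq \<equiv> subF (2 ^ e)"

definition q :: nat where "q = 2 ^ e"

definition \<sigma> :: "nat \<Rightarrow> 'a \<Rightarrow> 'a" where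
  "\<sigma> t x = x ^ (2 ^ (d * t))"

text \<open>The trace onto \<open>Fq\<close>, its conjugates listed in the order of
  \<open>\<sigma>\<close>, which makes it a \<open>\<sigma>\<close>-polynomial with all coefficients
  one.\<close>

definition T :: "'a \<Rightarrow> 'a" where
  "T x = (\<Sum>t<2 * s. \<sigma> t x)"

lemma s_pos: "0 < s" using k_pos k_le by simp

lemma q_ge_2: "2 \<le> q"
  unfolding q_def using e_pos by (metis one_le_numeral power_increasing power_one_right Suc_leI One_nat_def)

lemma card_field_q: "CARD('a) = q ^ (2 * s)"
  by (simp add: card_field m_eq q_def power_mult)

lemma card_Fq: "card Fq = q"
  unfolding q_def by (rule card_subF) (simp add: m_eq)

lemma gcd_m_d: "gcd d m = e"
proof -
  have "gcd (e * d') (e * (2 * s)) = e * gcd d' (2 * s)" by (rule gcd_mult_distrib_nat[symmetric])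
  then show ?thesis using coprime_d' by (simp add: d_eq m_eq)
qed

text \<open>By Bezout, an element fixed by the Frobenius powers \<open>d\<close> and
  \<open>m\<close> is fixed by the power \<open>gcd d m = e\<close>. Hence the root bound in terms
  of \<open>subF (2 ^ d)\<close> is a bound by powers of \<open>q\<close>.\<close>

lemma fixed_field: "subF (2 ^ d) = Fq"
proof
  show "subF (2 ^ d) \<subseteq> Fq"
  proof
    fix x :: 'a assume "x \<in> subF (2 ^ d)"
    then have x: "x ^ (2 ^ d) = x" by (simp add: subF_def)
    have "d \<noteq> 0" using odd_d' e_pos by (auto simp: d_eq intro: Nat.gr0I)
    then obtain a b where ab: "d * a = m * b + gcd d m" using bezout_nat by blast
    have "x = x ^ (2 ^ (d * a))" using frob_fixed_mult[OF x] by simp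
    also have "\<dots> = x ^ (2 ^ e)" using frob_period[of x e b] by (simp add: ab gcd_m_d add.commute)
    finally show "x \<in> Fq" by (simp add: subF_def)
  qed
  show "Fq \<subseteq> subF (2 ^ d)" using frob_fixed_mult by (auto simp: subF_def d_eq)
qed

lemma sigma_add: "\<sigma> t (x + y) = \<sigma> t x + \<sigma> t y" by (simp add: \<sigma>_def frob_add)
lemma sigma_mult: "\<sigma> t (x * y) = \<sigma> t x * \<sigma> t y" by (simp add: \<sigma>_def power_mult_distrib)
lemma sigma_sum: "\<sigma> t (\<Sum>i\<in>A. f i) = (\<Sum>i\<in>A. \<sigma> t (f i))" by (simp add: \<sigma>_def frob_sum)
lemma sigma_0 [simp]: "\<sigma> t 0 = 0" by (simp add: \<sigma>_def)
lemma sigma_0' [simp]: "\<sigma> 0 x = x" by (simp add: \<sigma>_def)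
lemma sigma_sigma: "\<sigma> i (\<sigma> j x) = \<sigma> (i + j) x"
  by (simp add: \<sigma>_def frob_frob add.commute distrib_left)
lemma sigma_inj: "\<sigma> t x = \<sigma> t y \<longleftrightarrow> x = y" by (simp add: \<sigma>_def frob_inj)
lemma sigma_Fq: "c \<in> Fq \<Longrightarrow> \<sigma> t c = c"
  unfolding fixed_field[symmetric] by (simp add: subF_def \<sigma>_def frob_fixed_mult)
lemma sigma_period: "\<sigma> (t + 2 * s * i) x = \<sigma> t x"
proof -
  have "d * (t + 2 * s * i) = d * t + m * (d' * i)" by (simp add: d_eq m_eq algebra_simps)
  then show ?thesis unfolding \<sigma>_def using frob_period by metis
qed
lemma sigma_mod: "\<sigma> (t mod (2 * s)) x = \<sigma> t x"
  using sigma_period[of "t mod (2 * s)" "t div (2 * s)"] by simp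
lemma sigma_2s: "\<sigma> (2 * s) x = x"
  using sigma_period[of 0 1] by simp
lemma sigma_s_s [simp]: "\<sigma> s (\<sigma> s x) = x"
  using sigma_2s[of x] by (simp only: sigma_sigma mult_2)
text \<open>As \<open>d'\<close> is odd, \<open>d * s\<close> is congruent to \<open>n\<close>
  modulo \<open>m\<close>: \<open>\<sigma> s\<close> is the conjugation over the subfield with
  \<open>2 ^ n\<close> elements.\<close>

lemma sigma_s: "\<sigma> s x = x ^ (2 ^ n)"
proof -
  obtain l where l: "d' = 2 * l + 1" using odd_d' by (elim oddE)
  have "d * s = n + m * l" by (simp add: d_eq n_eq m_eq l algebra_simps)
  then show ?thesis unfolding \<sigma>_def using frob_period by metis
qed
lemma subF_n: "x \<in> subF (2 ^ n) \<longleftrightarrow> \<sigma> s x = x"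
  by (simp add: sigma_s subF_def)
lemma tr_sigma: "tr (\<sigma> t x) = tr x" by (simp add: \<sigma>_def tr_frob)
lemma sigma_sum_shift: "(\<Sum>t<2 * s. \<sigma> (t + r) x) = (\<Sum>t<2 * s. \<sigma> t x)"
proof (induction r)
  case (Suc r)
  have "(\<Sum>t<2 * s. \<sigma> (t + Suc r) x) + \<sigma> r x = (\<Sum>t<Suc (2 * s). \<sigma> (t + r) x)"
    unfolding sum.lessThan_Suc_shift by (simp add: add.commute)
  also have "\<dots> = (\<Sum>t<2 * s. \<sigma> (t + r) x) + \<sigma> r x"
    using sigma_period[of r 1] by (simp add: add.commute)
  finally show ?case using Suc by simp
qed simp

lemma T_add: "T (x + y) = T x + T y" by (simp add: T_def sigma_add sum.distrib)
lemma T_0 [simp]: "T 0 = 0" by (simp add: T_def)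
lemma T_scale: "c \<in> Fq \<Longrightarrow> T (c * x) = c * T x"
  by (simp add: T_def sigma_mult sigma_Fq sum_distrib_left)
lemma T_sigma: "T (\<sigma> r x) = T x"
  by (simp add: T_def sigma_sigma sigma_sum_shift)
lemma sigma_T: "\<sigma> r (T x) = T x"
  using sigma_sum_shift[of r x] by (simp add: T_def sigma_sum sigma_sigma add.commute)
lemma T_Fq: "T x \<in> Fq"
  using sigma_T[of 1 x] unfolding fixed_field[symmetric] by (simp add: subF_def \<sigma>_def)

text \<open>The substitution \<open>x = \<sigma> r y\<close> rotates the exponents, so a cyclic
  window moves to \<open>0..D\<close>, where the root bound for linearized polynomials
  applies.\<close>

lemma card_window_roots:
  fixes c :: "nat \<Rightarrow> 'a"
  assumes nz: "\<exists>t<2 * s. c t \<noteq> 0" and D: "D < 2 * s"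
    and win: "\<And>t. t < 2 * s \<Longrightarrow> c t \<noteq> 0 \<Longrightarrow> (t + r) mod (2 * s) \<le> D"
  shows "card {x. (\<Sum>t<2 * s. c t * \<sigma> t x) = 0} \<le> q ^ D"
proof -
  let ?N = "2 * s"
  have N: "0 < ?N" using s_pos by simp
  \<comment> \<open>\<open>?N * r - r\<close> is a natural number congruent to \<open>- r\<close>
    modulo \<open>?N\<close>.\<close>
  define c' where "c' i = c ((i + (?N * r - r)) mod ?N)" for i
  have r: "r \<le> ?N * r" using N by simp
  have inv1: "((t + r) mod ?N + (?N * r - r)) mod ?N = t" if "t < ?N" for t
  proof -
    have "((t + r) mod ?N + (?N * r - r)) mod ?N = (t + r + (?N * r - r)) mod ?N"
      by (simp add: mod_add_left_eq)
    also have "t + r + (?N * r - r) = t + ?N * r" using r by linarith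
    finally show ?thesis using that by simp
  qed
  have inv2: "((t + (?N * r - r)) mod ?N + r) mod ?N = t" if "t < ?N" for t
  proof -
    have "((t + (?N * r - r)) mod ?N + r) mod ?N = (t + (?N * r - r) + r) mod ?N"
      by (simp add: mod_add_left_eq)
    also have "t + (?N * r - r) + r = t + ?N * r" using r by linarith
    finally show ?thesis using that by simp
  qed
  have key: "(\<Sum>t<?N. c t * \<sigma> t (\<sigma> r y)) = (\<Sum>i\<le>D. c' i * y ^ (2 ^ (d * i)))" for y
  proof -
    have "(\<Sum>t<?N. c t * \<sigma> t (\<sigma> r y)) = (\<Sum>i<?N. c' i * \<sigma> i y)"
      by (rule sum.reindex_bij_witness[where j = "\<lambda>t. (t + r) mod ?N" and i = "\<lambda>t. (t + (?N * r - r)) mod ?N"])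
        (use N inv1 inv2 in \<open>auto simp: c'_def sigma_sigma sigma_mod\<close>)
    also have "\<dots> = (\<Sum>i\<le>D. c' i * \<sigma> i y)"
    proof (rule sum.mono_neutral_right)
      show "\<forall>i\<in>{..<?N} - {..D}. c' i * \<sigma> i y = 0"
      proof
        fix i assume i: "i \<in> {..<?N} - {..D}"
        have "c' i = 0"
        proof (rule ccontr)
          assume "c' i \<noteq> 0"
          then have "((i + (?N * r - r)) mod ?N + r) mod ?N \<le> D"
            unfolding c'_def using N by (intro win) auto
          with i inv2 show False by auto
        qed
        then show "c' i * \<sigma> i y = 0" by simp
      qed
    qed (use D in auto)
    finally show ?thesis by (simp add: \<sigma>_def)
  qed
  obtain t0 where t0: "t0 < ?N" "c t0 \<noteq> 0" using nz by blast
  have "\<exists>i\<le>D. c' i \<noteq> 0"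
    using t0 win[OF t0] inv1[OF t0(1)] by (intro exI[of _ "(t0 + r) mod ?N"]) (simp add: c'_def)
  from card_linearized_roots[OF this, of d]
  have *: "card {y. (\<Sum>i\<le>D. c' i * y ^ (2 ^ (d * i))) = 0} \<le> q ^ D"
    by (simp add: fixed_field card_Fq)
  have "surj (\<sigma> r)" using sigma_inj by (intro finite_UNIV_inj_surj) (auto simp: inj_def)
  then have "{x. (\<Sum>t<?N. c t * \<sigma> t x) = 0} \<subseteq> \<sigma> r ` {y. (\<Sum>i\<le>D. c' i * y ^ (2 ^ (d * i))) = 0}"
    unfolding key[symmetric] by (auto simp: image_iff)
  then have "card {x. (\<Sum>t<?N. c t * \<sigma> t x) = 0} \<le> card {y. (\<Sum>i\<le>D. c' i * y ^ (2 ^ (d * i))) = 0}"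
    by (meson card_image_le card_mono finite finite_imageI le_trans)
  with * show ?thesis by linarith
qed

lemma T_nondegenerate: assumes "\<And>y. T (x * y) = 0" shows "x = 0"
proof (rule ccontr)
  assume x: "x \<noteq> 0"
  have "T y = 0" for y using assms[of "y / x"] x by simp
  then have "{x. (\<Sum>t<2 * s. 1 * \<sigma> t x) = 0} = UNIV" by (auto simp: T_def)
  moreover have "card {x. (\<Sum>t<2 * s. 1 * \<sigma> t x) = 0} \<le> q ^ (2 * s - 1)"
    by (rule card_window_roots[where r = 0]) (use s_pos in \<open>auto intro: exI[of _ 0]\<close>)
  ultimately have "q ^ (2 * s) \<le> q ^ (2 * s - 1)" by (simp add: card_field_q)
  then show False using q_ge_2 s_pos by (simp add: power_le_imp_le_exp power_increasing_iff)
qed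

section \<open>Subspaces over \<open>Fq\<close>, independent lists and the trace form\<close>

definition subspace :: "'a set \<Rightarrow> bool" where
  "subspace V \<longleftrightarrow> 0 \<in> V \<and> (\<forall>x\<in>V. \<forall>y\<in>V. x + y \<in> V) \<and> (\<forall>c\<in>Fq. \<forall>x\<in>V. c * x \<in> V)"

primrec span :: "'a list \<Rightarrow> 'a set" where
  "span [] = {0}"
| "span (x # xs) = {c * x + w |c w. c \<in> Fq \<and> w \<in> span xs}"

primrec indep :: "'a list \<Rightarrow> bool" where
  "indep [] \<longleftrightarrow> True"
| "indep (x # xs) \<longleftrightarrow> x \<notin> span xs \<and> indep xs"

lemma span_ConsI: "c \<in> Fq \<Longrightarrow> w \<in> span xs \<Longrightarrow> c * x + w \<in> span (x # xs)"
  unfolding span.simps by blast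

lemma subspace_span: "subspace (span xs)"
proof (induction xs)
  case (Cons x xs)
  show ?case
    unfolding subspace_def
  proof (intro conjI ballI)
    show "0 \<in> span (x # xs)" using Cons by (force simp: subspace_def intro: exI[of _ 0])
  next
    fix u v assume "u \<in> span (x # xs)" "v \<in> span (x # xs)"
    then obtain c w c' w' where "c \<in> Fq" "c' \<in> Fq" "w \<in> span xs" "w' \<in> span xs"
      "u = c * x + w" "v = c' * x + w'" by auto
    moreover from this have "u + v = (c + c') * x + (w + w')" "c + c' \<in> Fq" "w + w' \<in> span xs"
      using Cons by (simp_all add: algebra_simps subF_add subspace_def)
    ultimately show "u + v \<in> span (x # xs)" unfolding span.simps by blast
  next
    fix a u assume "a \<in> Fq" "u \<in> span (x # xs)"
    then obtain c w where "c \<in> Fq" "w \<in> span xs" "u = c * x + w" by auto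
    moreover from this have "a * u = (a * c) * x + a * w" "a * c \<in> Fq" "a * w \<in> span xs"
      using Cons \<open>a \<in> Fq\<close> by (simp_all add: algebra_simps subF_mult subspace_def)
    ultimately show "a * u \<in> span (x # xs)" unfolding span.simps by blast
  qed
qed (auto simp: subspace_def)

lemma span_subset: "subspace V \<Longrightarrow> set xs \<subseteq> V \<Longrightarrow> span xs \<subseteq> V"
  by (induction xs) (auto simp: subspace_def)

lemma span_Cons_superset: "span xs \<subseteq> span (x # xs)"
  by (force intro: exI[of _ 0])

lemma card_span: "indep xs \<Longrightarrow> card (span xs) = q ^ length xs"
proof (induction xs)
  case (Cons x xs)
  have inj: "inj_on (\<lambda>(c, w). c * x + w) (Fq \<times> span xs)"
  proof (intro inj_onI; clarify)
    fix c w c' w'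
    assume a: "c \<in> Fq" "w \<in> span xs" "c' \<in> Fq" "w' \<in> span xs" "c * x + w = c' * x + w'"
    have "(c + c') * x = w + w'"
    proof -
      have "(c * x + w) + (c' * x + w) = (c' * x + w') + (c' * x + w)" using a(5) by simp
      then show ?thesis by (simp add: ac_simps distrib_left)
    qed
    moreover have "w + w' \<in> span xs" using a subspace_span by (auto simp: subspace_def)
    ultimately have "inverse (c + c') * ((c + c') * x) \<in> span xs"
      using a subspace_span[of xs] by (auto simp: subspace_def intro!: subF_inverse subF_add)
    then have "c + c' = 0" using Cons.prems by (cases "c + c' = 0") (simp_all add: mult.assoc[symmetric])
    then have "c = c'" by (simp add: add_eq_0)
    then show "c = c' \<and> w = w'" using a(5) by auto
  qed
  have "span (x # xs) = (\<lambda>(c, w). c * x + w) ` (Fq \<times> span xs)" by auto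
  then show ?case using Cons card_image[OF inj] by (simp add: card_cartesian_product card_Fq del: span.simps)
qed simp

lemma card_indep_lists:
  assumes V: "subspace V"
  shows "real (card {xs. length xs = u \<and> set xs \<subseteq> V \<and> indep xs}) = (\<Prod>i<u. real (card V) - real q ^ i)"
proof (induction u)
  case 0
  have "{xs. length xs = 0 \<and> set xs \<subseteq> V \<and> indep xs} = {[]}" by auto
  then show ?case by simp
next
  case (Suc u)
  let ?A = "\<lambda>u. {xs. length xs = u \<and> set xs \<subseteq> V \<and> indep xs}"
  have fin: "finite (?A u)" by (rule finite_subset[OF _ finite_lists_length_UNIV[of u]]) auto
  have "?A (Suc u) = (\<lambda>(xs, x). x # xs) ` (SIGMA xs:?A u. V - span xs)"
    by (auto simp: length_Suc_conv image_iff)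
  then have "card (?A (Suc u)) = card (SIGMA xs:?A u. V - span xs)"
    by (simp add: card_image inj_on_def)
  also have "real \<dots> = (\<Sum>xs\<in>?A u. real (card (V - span xs)))"
    using fin by simp
  also have "\<dots> = (\<Sum>xs\<in>?A u. real (card V) - real q ^ u)"
  proof (rule sum.cong)
    fix xs assume xs: "xs \<in> ?A u"
    then have sub: "span xs \<subseteq> V" using span_subset[OF V] by auto
    then have "card (V - span xs) = card V - card (span xs)" by (simp add: card_Diff_subset)
    moreover have "card (span xs) \<le> card V" using sub by (simp add: card_mono)
    moreover have "card (span xs) = q ^ u" using xs by (simp add: card_span)
    ultimately show "real (card (V - span xs)) = real (card V) - real q ^ u" by (simp add: of_nat_diff)
  qed simp
  also have "\<dots> = (\<Prod>i<Suc u. real (card V) - real q ^ i)" using Suc by simp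
  finally show ?case .
qed

text \<open>The double annihilator under the trace form. Unless \<open>x'\<close> is redundant, some
  \<open>y0\<close> is dual to \<open>x'\<close> and kills \<open>xs\<close>; then
  \<open>z + T (z * y0) * x'\<close> falls under the induction hypothesis.\<close>

lemma in_span_if_annihilated:
  assumes "\<And>y. (\<And>x. x \<in> set xs \<Longrightarrow> T (x * y) = 0) \<Longrightarrow> T (z * y) = 0"
  shows "z \<in> span xs"
  using assms
proof (induction xs arbitrary: z)
  case Nil
  then show ?case using T_nondegenerate by auto
next
  case (Cons x' xs)
  show ?case
  proof (cases "\<forall>y. (\<forall>x\<in>set xs. T (x * y) = 0) \<longrightarrow> T (x' * y) = 0")
    case True
    then have "z \<in> span xs" using Cons.prems by (intro Cons.IH) auto
    then show ?thesis using span_Cons_superset by blast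
  next
    case False
    then obtain y1 where y1: "\<forall>x\<in>set xs. T (x * y1) = 0" "T (x' * y1) \<noteq> 0" by blast
    define y0 where "y0 = inverse (T (x' * y1)) * y1"
    have sc: "T (x * y0) = inverse (T (x' * y1)) * T (x * y1)" for x
      using T_scale[OF subF_inverse[OF T_Fq], of "x' * y1" "x * y1"] by (simp add: y0_def mult.left_commute)
    have y0: "\<forall>x\<in>set xs. T (x * y0) = 0" "T (x' * y0) = 1" using y1 sc by auto
    define c where "c = T (z * y0)"
    have c: "c \<in> Fq" by (simp add: c_def T_Fq)
    have "z + c * x' \<in> span xs"
    proof (rule Cons.IH)
      fix y assume y: "\<And>x. x \<in> set xs \<Longrightarrow> T (x * y) = 0"
      \<comment> \<open>Adding \<open>b * y0\<close> makes \<open>y\<close> orthogonal to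
        \<open>x'\<close> as well and keeps it orthogonal to \<open>xs\<close>.\<close>
      define b where "b = T (x' * y)"
      have lin: "T (x * (y + b * y0)) = T (x * y) + b * T (x * y0)" for x
        using T_scale[of b "x * y0"] by (simp add: b_def T_Fq distrib_left T_add mult.left_commute)
      have "T (z * (y + b * y0)) = 0"
        by (rule Cons.prems) (use y y0 lin in \<open>auto simp: b_def\<close>)
      then have "T (z * y) + b * c = 0" using lin by (simp add: c_def)
      moreover have "T (c * x' * y) = c * b" using T_scale[OF c, of "x' * y"] by (simp add: b_def mult.assoc)
      ultimately show "T ((z + c * x') * y) = 0" by (metis distrib_right T_add mult.commute)
    qed
    from span_ConsI[OF c this, of x'] show ?thesis by (simp add: add.left_commute)
  qed
qed

text \<open>Each entry imposes one equation with values in \<open>Fq\<close>, which divides the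
  number of solutions by at most \<open>q\<close>.\<close>

lemma card_annihilator: "q ^ (2 * s) \<le> q ^ length xs * card {y. \<forall>x\<in>set xs. T (x * y) = 0}"
proof (induction xs)
  case Nil
  then show ?case by (simp add: card_field_q)
next
  case (Cons x xs)
  let ?G = "{y. \<forall>x\<in>set xs. T (x * y) = 0}"
  have "card ?G = card ((\<lambda>y. T (x * y)) ` ?G) * card {y\<in>?G. T (x * y) = 0}"
    by (rule card_additive_kernel) (auto simp: T_add distrib_left)
  also have "\<dots> \<le> q * card {y\<in>?G. T (x * y) = 0}"
    unfolding card_Fq[symmetric] by (intro mult_right_mono card_mono) (auto simp: T_Fq)
  also have "{y\<in>?G. T (x * y) = 0} = {y. \<forall>x\<in>set (x # xs). T (x * y) = 0}" by auto
  finally have "card ?G \<le> q * card {y. \<forall>x\<in>set (x # xs). T (x * y) = 0}" .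
  then have "q ^ length xs * card ?G \<le> q ^ length xs * (q * card {y. \<forall>x\<in>set (x # xs). T (x * y) = 0})"
    by (rule mult_left_mono) simp
  with Cons have "q ^ (2 * s) \<le> q ^ length xs * (q * card {y. \<forall>x\<in>set (x # xs). T (x * y) = 0})"
    by (rule le_trans)
  then show ?case by (simp only: length_Cons power_Suc mult_ac)
qed

text \<open>The bivector \<open>\<Sum> x\<^sub>i \<and> z\<^sub>i\<close> acting as an alternating map, and its coefficients as a
  \<open>\<sigma>\<close>-polynomial. Both are meaningful only for lists of equal length, because of the junk values of
  \<open>hd\<close> and \<open>tl\<close>.\<close>
primrec wedge :: "'a list \<Rightarrow> 'a list \<Rightarrow> 'a \<Rightarrow> 'a" where
  "wedge [] zs y = 0"
| "wedge (x # xs) zs y = x * T (hd zs * y) + hd zs * T (x * y) + wedge xs (tl zs) y"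

primrec wcoef :: "nat \<Rightarrow> 'a list \<Rightarrow> 'a list \<Rightarrow> 'a" where
  "wcoef t [] zs = 0"
| "wcoef t (x # xs) zs = x * \<sigma> t (hd zs) + hd zs * \<sigma> t x + wcoef t xs (tl zs)"

lemma wedge_expand: "wedge xs zs y = (\<Sum>t<2 * s. wcoef t xs zs * \<sigma> t y)"
proof (induction xs arbitrary: zs)
  case (Cons x xs)
  have "(\<Sum>t<2 * s. wcoef t (x # xs) zs * \<sigma> t y)
      = x * T (hd zs * y) + hd zs * T (x * y) + (\<Sum>t<2 * s. wcoef t xs (tl zs) * \<sigma> t y)"
    by (simp add: distrib_right sum.distrib T_def sigma_mult sum_distrib_left mult.assoc)
  then show ?case using Cons by simp
qed simp

lemma wedge_annihilated:
  "length zs = length xs \<Longrightarrow> (\<And>x. x \<in> set xs \<union> set zs \<Longrightarrow> T (x * y) = 0) \<Longrightarrow> wedge xs zs y = 0"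
proof (induction xs arbitrary: zs)
  case (Cons x xs)
  then obtain z zs' where "zs = z # zs'" by (cases zs) auto
  with Cons show ?case by auto
qed simp

text \<open>With exponents below \<open>2 * s\<close>, a nonzero \<open>\<sigma>\<close>-polynomial
  has at most \<open>q ^ (2 * s - 1)\<close> roots, so the map determines its coefficients.\<close>

lemma wcoef_zero_if_wedge_zero:
  assumes "\<And>y. wedge xs zs y = 0" and "t < 2 * s"
  shows "wcoef t xs zs = 0"
proof (rule ccontr)
  assume "wcoef t xs zs \<noteq> 0"
  then have "card {y. (\<Sum>t<2 * s. wcoef t xs zs * \<sigma> t y) = 0} \<le> q ^ (2 * s - 1)"
    using assms(2) by (intro card_window_roots[where r = 0]) auto
  then have "q ^ (2 * s) \<le> q ^ (2 * s - 1)"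
    using assms(1) by (simp add: wedge_expand[symmetric] card_field_q)
  then show False using q_ge_2 s_pos by (simp add: power_increasing_iff)
qed

text \<open>The image of \<open>wedge xs zs\<close> has small dimension while a nonzero linearized polynomial with
  a short window of coefficients has a small kernel.\<close>
lemma wedge_zero_if_wcoef_zero:
  assumes len: "length zs = length xs" and u: "length xs < k"
    and w: "\<And>t. s - k < t \<Longrightarrow> t < s + k \<Longrightarrow> wcoef t xs zs = 0"
  shows "wedge xs zs y = 0"
proof (rule ccontr)
  assume nz: "wedge xs zs y \<noteq> 0"
  then have ex: "\<exists>t<2 * s. wcoef t xs zs \<noteq> 0"
  proof (rule contrapos_np)
    assume "\<not> (\<exists>t<2 * s. wcoef t xs zs \<noteq> 0)"
    then show "wedge xs zs y = 0" unfolding wedge_expand by (intro sum.neutral) auto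
  qed
  have "card {y. (\<Sum>t<2 * s. wcoef t xs zs * \<sigma> t y) = 0} \<le> q ^ (2 * (s - k))"
  \<comment> \<open>The surviving exponents \<open>s + k..2 * s - 1\<close> and
    \<open>0..s - k\<close> are cyclically consecutive; rotation by \<open>s - k\<close> makes them
    start at \<open>0\<close>.\<close>
  proof (rule card_window_roots[OF ex, where r = "s - k"])
    show "2 * (s - k) < 2 * s" using k_pos k_le by simp
    fix t assume t: "t < 2 * s" "wcoef t xs zs \<noteq> 0"
    then have "t \<le> s - k \<or> s + k \<le> t" using w[of t] by (metis not_less)
    then show "(t + (s - k)) mod (2 * s) \<le> 2 * (s - k)"
    proof
      assume "s + k \<le> t"
      then have "t + (s - k) = (t - s - k) + 2 * s" using k_le by simp
      then have "(t + (s - k)) mod (2 * s) = (t - s - k) mod (2 * s)" by simp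
      also have "\<dots> \<le> t - s - k" by simp
      finally show ?thesis using t(1) by simp
    next
      assume "t \<le> s - k"
      have "(t + (s - k)) mod (2 * s) \<le> t + (s - k)" by simp
      with \<open>t \<le> s - k\<close> show ?thesis by linarith
    qed
  qed
  then have up: "card {y. wedge xs zs y = 0} \<le> q ^ (2 * (s - k))" by (simp add: wedge_expand)
  \<comment> \<open>The kernel contains the annihilator of both lists, of at least
    \<open>q ^ (2 * s - 2 * length xs)\<close> elements; this forces
    \<open>k \<le> length xs\<close>.\<close>
  have "{y. \<forall>x\<in>set (xs @ zs). T (x * y) = 0} \<subseteq> {y. wedge xs zs y = 0}"
    using wedge_annihilated[OF len] by auto
  then have "card {y. \<forall>x\<in>set (xs @ zs). T (x * y) = 0} \<le> q ^ (2 * (s - k))"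
    using up by (meson card_mono finite le_trans)
  then have "q ^ (2 * s) \<le> q ^ length (xs @ zs) * q ^ (2 * (s - k))"
    using card_annihilator[of "xs @ zs"] by (meson mult_le_mono2 le_trans)
  then have "2 * s \<le> 2 * length xs + 2 * (s - k)"
    using q_ge_2 len by (simp add: power_add[symmetric] power_increasing_iff)
  then show False using u k_le by simp
qed

lemma wedge_add:
  "length zs = length xs \<Longrightarrow> length ws = length xs \<Longrightarrow>
    wedge xs (map2 (+) ws zs) y = wedge xs ws y + wedge xs zs y"
proof (induction xs arbitrary: zs ws)
  case (Cons x xs)
  obtain z zs' w ws' where "zs = z # zs'" "ws = w # ws'" using Cons.prems
    by (metis length_Suc_conv)
  with Cons show ?case by (simp add: T_add algebra_simps)
qed simp

text \<open>Bilinearity: for \<open>w = \<Sum> c\<^sub>i * x\<^sub>i\<close> the summand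
  \<open>x \<and> w\<close> is redistributed as
  \<open>\<Sum> x\<^sub>i \<and> (c\<^sub>i * x)\<close>, without signs in characteristic
  two.\<close>

lemma wedge_transfer:
  "w \<in> span xs \<Longrightarrow> \<exists>ws. length ws = length xs \<and> (\<forall>y. x * T (w * y) + w * T (x * y) = wedge xs ws y)"
proof (induction xs arbitrary: w)
  case (Cons x1 xs)
  then obtain c w' where c: "c \<in> Fq" "w' \<in> span xs" "w = c * x1 + w'" by auto
  obtain ws where ws: "length ws = length xs" "\<And>y. x * T (w' * y) + w' * T (x * y) = wedge xs ws y"
    using Cons.IH[OF c(2)] by blast
  have "x * T (w * y) + w * T (x * y) = wedge (x1 # xs) ((c * x) # ws) y" for y
    using T_scale[OF c(1), of "x * y"] T_scale[OF c(1), of "x1 * y"] ws(2)[of y, symmetric]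
    by (simp add: c(3) distrib_right T_add algebra_simps)
  then show ?case using ws(1) by (intro exI[of _ "(c * x) # ws"]) auto
qed simp

definition wkernel :: "'a list \<Rightarrow> 'a list set" where
  "wkernel xs = {zs. length zs = length xs \<and> (\<forall>y. wedge xs zs y = 0)}"

lemma map2_add_cancel: "length ws = length zs \<Longrightarrow> map2 (+) ws (map2 (+) ws zs) = (zs :: 'a list)"
  by (induction ws zs rule: list_induct2) auto

text \<open>Cartan's lemma in counting form: the \<open>z\<^sub>i\<close> are combinations of the
  \<open>x\<^sub>i\<close> with a symmetric matrix. The induction chooses the first \<open>z\<close>
  freely in the span; the remaining entries then form a coset of the kernel for the shorter
  list.\<close>

lemma card_wkernel: "indep xs \<Longrightarrow> card (wkernel xs) = q ^ (Suc (length xs) choose 2)"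
proof (induction xs)
  case Nil
  have "wkernel [] = {[]}" by (auto simp: wkernel_def)
  then show ?case by (simp add: numeral_2_eq_2)
next
  case (Cons x xs)
  let ?fib = "\<lambda>z. {zs. z # zs \<in> wkernel (x # xs)}"
  have in_span: "z \<in> span (x # xs)" if zs: "z # zs \<in> wkernel (x # xs)" for z zs
  proof -
    \<comment> \<open>Evaluating the relation at a \<open>y1\<close> that kills \<open>xs\<close>
      but not \<open>x\<close> isolates a nonzero multiple of \<open>z\<close> modulo the
      span.\<close>
    obtain y1 where y1: "\<And>x'. x' \<in> set xs \<Longrightarrow> T (x' * y1) = 0" "T (x * y1) \<noteq> 0"
      using in_span_if_annihilated[of xs x] Cons.prems by auto
    have low: "wedge xs zs y1 \<in> span xs" if "length zs = length xs" for zs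
    proof -
      have "wedge us zs y1 \<in> span us" if "\<And>x'. x' \<in> set us \<Longrightarrow> T (x' * y1) = 0" for us zs
        using that
      proof (induction us arbitrary: zs)
        case (Cons u us)
        have "wedge (u # us) zs y1 = T (hd zs * y1) * u + wedge us (tl zs) y1"
          using Cons.prems[of u] by (simp add: mult.commute)
        moreover have "wedge us (tl zs) y1 \<in> span us" by (rule Cons.IH) (use Cons.prems in simp)
        ultimately show ?case
          using span_ConsI[OF T_Fq, of "wedge us (tl zs) y1" us "hd zs * y1" u] by (simp only:)
      qed simp
      then show ?thesis using y1 by blast
    qed
    have "x * T (z * y1) + z * T (x * y1) + wedge xs zs y1 = 0"
      using zs by (simp add: wkernel_def)
    then have "T (x * y1) * z + (T (z * y1) * x + wedge xs zs y1) = 0" by (simp add: ac_simps)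
    then have eq: "T (x * y1) * z = T (z * y1) * x + wedge xs zs y1" by (simp only: add_eq_0)
    have "T (x * y1) * z \<in> span (x # xs)"
      unfolding eq using low zs by (intro span_ConsI T_Fq) (auto simp: wkernel_def)
    then have "inverse (T (x * y1)) * (T (x * y1) * z) \<in> span (x # xs)"
      using subspace_span[of "x # xs"] subF_inverse[OF T_Fq] unfolding subspace_def by blast
    then show ?thesis using y1(2) by (simp add: mult.assoc[symmetric] del: span.simps)
  qed
  have fib: "card (?fib z) = card (wkernel xs)" if z: "z \<in> span (x # xs)" for z
  proof -
    obtain c w where c: "c \<in> Fq" "w \<in> span xs" "z = c * x + w" using z by auto
    obtain ws where ws: "length ws = length xs" "\<And>y. x * T (w * y) + w * T (x * y) = wedge xs ws y"
      using wedge_transfer[OF c(2)] by blast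
    have "x * T (z * y) + z * T (x * y) = wedge xs ws y" for y
      using T_scale[OF c(1), of "x * y"] ws(2)[of y, symmetric]
      by (simp add: c(3) distrib_right T_add algebra_simps)
    then have W: "wedge (x # xs) (z # zs) y = wedge xs (map2 (+) ws zs) y" if "length zs = length xs" for zs y
      using that ws(1) by (simp add: wedge_add)
    \<comment> \<open>Moving \<open>x \<and> z\<close> onto \<open>xs\<close> turns the fibre into a
      translate of \<open>wkernel xs\<close>; the translation is its own inverse.\<close>
    have "bij_betw (map2 (+) ws) (?fib z) (wkernel xs)"
    proof (rule bij_betw_byWitness[where f' = "map2 (+) ws"])
      show "map2 (+) ws ` ?fib z \<subseteq> wkernel xs"
        using W ws(1) by (auto simp: wkernel_def simp del: wedge.simps)
      show "map2 (+) ws ` wkernel xs \<subseteq> ?fib z"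
      proof clarify
        fix zs assume "zs \<in> wkernel xs"
        then show "z # map2 (+) ws zs \<in> wkernel (x # xs)"
          using W[of "map2 (+) ws zs"] ws(1) by (auto simp: wkernel_def map2_add_cancel simp del: wedge.simps)
      qed
    qed (use ws(1) in \<open>auto simp: wkernel_def map2_add_cancel\<close>)
    then show ?thesis by (rule bij_betw_same_card)
  qed
  have finf: "finite (?fib z)" for z
    by (rule finite_subset[OF _ finite_lists_length_UNIV[of "length xs"]]) (auto simp: wkernel_def)
  have "wkernel (x # xs) = (\<lambda>(z, zs). z # zs) ` (SIGMA z:span (x # xs). ?fib z)"
    using in_span by (auto simp: wkernel_def image_iff length_Suc_conv simp del: span.simps wedge.simps)
  then have "card (wkernel (x # xs)) = card ((\<lambda>(z, zs). z # zs) ` (SIGMA z:span (x # xs). ?fib z))"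
    by (simp only:)
  also have "\<dots> = card (SIGMA z:span (x # xs). ?fib z)"
    by (intro card_image) (auto simp: inj_on_def)
  also have "\<dots> = (\<Sum>z\<in>span (x # xs). card (?fib z))"
    using finf by (intro card_SigmaI) auto
  also have "\<dots> = q ^ length (x # xs) * card (wkernel xs)"
    using fib card_span[OF Cons.prems] by (simp del: span.simps)
  also have "\<dots> = q ^ (Suc (length (x # xs)) choose 2)"
    using Cons by (simp add: numeral_2_eq_2 power_add)
  finally show ?case .
qed

section \<open>Polar forms and their radicals\<close>

definition coef_dom :: "nat \<Rightarrow> 'a set" where
  "coef_dom j = (if j = 0 then subF (2 ^ n) else UNIV)"

text \<open>The coefficient \<open>a\<^sub>k\<close> is left out because it contributes only a
  linear term, which the polar form ignores. Extensionality gives one function per tuple.\<close>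

definition Y :: "(nat \<Rightarrow> 'a) set" where
  "Y = PiE {..<k} coef_dom"

text \<open>\<open>lin a\<close> is the map \<open>L\<close> with polar form \<open>Tr (x * L y)\<close>; here \<open>\<sigma> (s + j)\<close> is the adjoint of
  \<open>\<sigma> (s - j)\<close>, since \<open>\<sigma>\<close> has order \<open>2 * s\<close>.\<close>
definition lin :: "(nat \<Rightarrow> 'a) \<Rightarrow> 'a \<Rightarrow> 'a" where
  "lin a x = a 0 * \<sigma> s x + (\<Sum>j\<in>{1..<k}. a j * \<sigma> (s - j) x + \<sigma> (s + j) (a j * x))"

definition rad :: "(nat \<Rightarrow> 'a) \<Rightarrow> 'a set" where
  "rad a = {x. lin a x = 0}"

text \<open>The cofactor of \<open>a j\<close> in \<open>z * lin a x\<close> after applying an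
  additive map invariant under \<open>\<sigma>\<close>. At \<open>j = 0\<close> there is one term
  because \<open>lin\<close> has only one there.\<close>

definition qcoef :: "nat \<Rightarrow> 'a \<Rightarrow> 'a \<Rightarrow> 'a" where
  "qcoef j x z = (if j = 0 then x * \<sigma> s z else x * \<sigma> (s - j) z + z * \<sigma> (s - j) x)"

lemma lessThan_k: "{..<k} = insert 0 {1..<k}"
  using k_pos by auto

lemma card_Y: "card Y = 2 ^ (n + m * (k - 1))"
proof -
  have "card Y = (\<Prod>j<k. card (coef_dom j))" by (simp add: Y_def card_PiE)
  also have "\<dots> = card (subF (2 ^ n) :: 'a set) * (\<Prod>j\<in>{1..<k}. 2 ^ m)"
    unfolding lessThan_k by (subst prod.insert) (auto simp: coef_dom_def card_field)
  also have "card (subF (2 ^ n) :: 'a set) = 2 ^ n"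
    by (rule card_subF) (simp add: n_eq m_eq)
  finally show ?thesis by (simp add: power_add power_mult)
qed

lemma Y_0: "a \<in> Y \<Longrightarrow> a 0 \<in> subF (2 ^ n)"
  using PiE_mem[of a "{..<k}" coef_dom 0] k_pos by (simp add: Y_def coef_dom_def)

lemma finite_Y: "finite Y"
  by (auto simp: Y_def coef_dom_def intro!: finite_PiE)

text \<open>Stated for a general invariant \<open>f\<close> since it serves both \<open>tr\<close>,
  in the character sums, and \<open>T\<close>, for the form over \<open>Fq\<close>. Invariance moves
  the adjoint terms back, as \<open>\<sigma> (s - j)\<close> inverts
  \<open>\<sigma> (s + j)\<close>.\<close>

lemma pairing:
  assumes a: "a 0 \<in> subF (2 ^ n)"
    and f: "\<And>x y. f (x + y) = f x + f y" "f 0 = (0::'a)" "\<And>t x. f (\<sigma> t x) = f x"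
  shows "f (z * lin a x) = (\<Sum>j<k. f (a j * qcoef j x z))"
proof -
  have fsum: "f (sum g A) = (\<Sum>i\<in>A. f (g i))" if "finite A" for g :: "nat \<Rightarrow> 'a" and A
    using that by (induction A rule: finite_induct) (simp_all add: f(1,2))
  have 0: "f (z * (a 0 * \<sigma> s x)) = f (a 0 * qcoef 0 x z)"
  proof -
    have "\<sigma> s (a 0 * qcoef 0 x z) = z * (a 0 * \<sigma> s x)"
      using a by (simp add: qcoef_def sigma_mult subF_n ac_simps)
    then show ?thesis by (metis f(3))
  qed
  have 1: "f (z * (a j * \<sigma> (s - j) x + \<sigma> (s + j) (a j * x))) = f (a j * qcoef j x z)" if j: "j \<in> {1..<k}" for j
  proof -
    have "\<sigma> (s - j) (z * \<sigma> (s + j) (a j * x)) = a j * (x * \<sigma> (s - j) z)"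
    proof -
      have "s - j + (s + j) = 2 * s" using j k_le by auto
      then have "\<sigma> (s - j) (\<sigma> (s + j) y) = y" for y using sigma_2s[of y] by (simp only: sigma_sigma)
      then show ?thesis by (simp only: sigma_mult[of "s - j" z]) (simp only: ac_simps)
    qed
    then have "f (z * \<sigma> (s + j) (a j * x)) = f (a j * (x * \<sigma> (s - j) z))" by (metis f(3))
    then show ?thesis using j by (simp add: qcoef_def f(1) distrib_left ac_simps)
  qed
  have "f (z * lin a x) = f (z * (a 0 * \<sigma> s x)) + (\<Sum>j\<in>{1..<k}. f (z * (a j * \<sigma> (s - j) x + \<sigma> (s + j) (a j * x))))"
    by (simp add: lin_def distrib_left[of z] f(1) sum_distrib_left fsum)
  also have "\<dots> = (\<Sum>j<k. f (a j * qcoef j x z))"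
    unfolding lessThan_k using 0 1 by (subst sum.insert) auto
  finally show ?thesis .
qed

lemma lin_add: "lin a (x + y) = lin a x + lin a y"
  by (simp add: lin_def sigma_add distrib_left sum.distrib ac_simps)

lemma lin_scale: "c \<in> Fq \<Longrightarrow> lin a (c * x) = c * lin a x"
  by (simp add: lin_def sigma_mult sigma_Fq sum_distrib_left distrib_left ac_simps)

lemma lin_0 [simp]: "lin a 0 = 0"
  by (simp add: lin_def)

lemma subspace_rad: "subspace (rad a)"
  by (auto simp: subspace_def rad_def lin_add lin_scale)

section \<open>Counting the tuples whose radical contains a given list\<close>

primrec linpair :: "(nat \<Rightarrow> 'a) \<Rightarrow> 'a list \<Rightarrow> 'a list \<Rightarrow> 'a" where
  "linpair a [] zs = 0"
| "linpair a (x # xs) zs = hd zs * lin a x + linpair a xs (tl zs)"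

primrec qcoefs :: "nat \<Rightarrow> 'a list \<Rightarrow> 'a list \<Rightarrow> 'a" where
  "qcoefs j [] zs = 0"
| "qcoefs j (x # xs) zs = qcoef j x (hd zs) + qcoefs j xs (tl zs)"

lemma sum_psi_linpair:
  "(\<Sum>zs | length zs = length xs. \<psi> (linpair a xs zs))
    = (if \<forall>x\<in>set xs. lin a x = 0 then 2 ^ (m * length xs) else 0)"
proof (induction xs)
  case (Cons x xs)
  have "(\<Sum>zs | length zs = length (x # xs). \<psi> (linpair a (x # xs) zs))
      = (\<Sum>z\<in>UNIV. \<psi> (lin a x * z)) * (\<Sum>zs | length zs = length xs. \<psi> (linpair a xs zs))"
    by (simp add: sum_lists_length_Suc psi_add sum_product mult.commute)
  then show ?case using Cons by (simp add: sum_psi power_add)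
qed simp

lemma tr_linpair:
  "a 0 \<in> subF (2 ^ n) \<Longrightarrow> tr (linpair a xs zs) = (\<Sum>j<k. tr (a j * qcoefs j xs zs))"
proof (induction xs arbitrary: zs)
  case (Cons x xs)
  have "tr (hd zs * lin a x) = (\<Sum>j<k. tr (a j * qcoef j x (hd zs)))"
    by (rule pairing) (use Cons in \<open>auto simp: tr_add tr_sigma\<close>)
  with Cons show ?case by (simp add: tr_add distrib_left sum.distrib)
qed simp

text \<open>Separates the coefficients, so that a sum over \<open>Y\<close> becomes a product of
  sums over the single \<open>a j\<close>.\<close>

lemma psi_linpair:
  assumes "a 0 \<in> subF (2 ^ n)"
  shows "\<psi> (linpair a xs zs) = (\<Prod>j<k. \<psi> (a j * qcoefs j xs zs))"
proof -
  have "tr (linpair a xs zs) = tr (\<Sum>j<k. a j * qcoefs j xs zs)"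
    using tr_linpair[of a xs zs] assms by (simp add: tr_sum)
  then have "\<psi> (linpair a xs zs) = \<psi> (\<Sum>j<k. a j * qcoefs j xs zs)" by (simp add: \<psi>_def)
  then show ?thesis by (simp add: psi_sum)
qed

definition trn :: "'a \<Rightarrow> 'a" where
  "trn y = (\<Sum>j<n. y ^ (2 ^ j))"

lemma trn_add: "trn (x + y) = trn x + trn y" by (simp add: trn_def frob_add sum.distrib)

lemma trn_0 [simp]: "trn 0 = 0" using trn_add[of 0 0] by simp

text \<open>Transitivity of the trace: \<open>w + \<sigma> s w\<close> is the relative trace to the
  subfield with \<open>2 ^ n\<close> elements, on which \<open>trn\<close> is the absolute
  trace.\<close>

lemma trn_norm: "trn (w + \<sigma> s w) = tr w"
proof -
  have mn: "m = n + n" by (simp add: m_eq n_eq)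
  have split: "{..<m} = {..<n} \<union> {n..<n + n}" unfolding mn by auto
  have 1: "tr w = (\<Sum>j<n. w ^ (2 ^ j)) + (\<Sum>j\<in>{n..<n + n}. w ^ (2 ^ j))"
    unfolding tr_def split by (rule sum.union_disjoint) auto
  have 2: "(\<Sum>j\<in>{n..<n + n}. w ^ (2 ^ j)) = (\<Sum>j<n. w ^ (2 ^ (n + j)))"
    by (rule sum.reindex_bij_witness[where i = "\<lambda>j. n + j" and j = "\<lambda>j. j - n"]) auto
  have 3: "(w + \<sigma> s w) ^ (2 ^ j) = w ^ (2 ^ j) + w ^ (2 ^ (n + j))" for j
    by (simp only: sigma_s frob_add frob_frob)
  show ?thesis unfolding 1 2 trn_def 3 by (rule sum.distrib)
qed

text \<open>The map \<open>w \<mapsto> w + \<sigma> s w\<close> is self-adjoint for the trace form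
  and has values in the subfield, so its kernel contains the orthogonal complement of the subfield;
  transitivity of the trace gives the converse.\<close>

lemma sum_psi_subF_n: "(\<Sum>c\<in>subF (2 ^ n). \<psi> (c * w)) = (if w + \<sigma> s w = 0 then int (card (subF (2 ^ n) :: 'a set)) else 0)"
proof -
  have "(\<forall>c\<in>subF (2 ^ n). \<psi> (c * w) = 1) \<longleftrightarrow> w + \<sigma> s w = 0"
  proof
    assume h: "\<forall>c\<in>subF (2 ^ n). \<psi> (c * w) = 1"
    show "w + \<sigma> s w = 0"
    proof (rule tr_nondegenerate)
      fix v
      have "v + \<sigma> s v \<in> subF (2 ^ n)"
        by (simp add: subF_n sigma_add add.commute)
      then have "tr ((v + \<sigma> s v) * w) = 0" using h by (simp add: psi_eq_1)
      moreover have "tr (\<sigma> s v * w) = tr (v * \<sigma> s w)"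
      proof -
        have "\<sigma> s (v * \<sigma> s w) = \<sigma> s v * w"
          by (simp add: sigma_mult)
        then show ?thesis by (metis tr_sigma)
      qed
      ultimately show "tr ((w + \<sigma> s w) * v) = 0" by (simp add: distrib_left distrib_right tr_add mult.commute)
    qed
  next
    assume h: "w + \<sigma> s w = 0"
    show "\<forall>c\<in>subF (2 ^ n). \<psi> (c * w) = 1"
    proof
      fix c :: 'a assume "c \<in> subF (2 ^ n)"
      then have "tr (c * w) = trn (c * (w + \<sigma> s w))"
        by (simp add: trn_norm[symmetric] sigma_mult subF_n distrib_left)
      then show "\<psi> (c * w) = 1" using h by (simp add: psi_eq_1 trn_0)
    qed
  qed
  then show ?thesis
    by (subst sum_sign_character) (auto simp: psi_add distrib_right subF_add)
qed

text \<open>The bivector map is self-adjoint, so opposite coefficients are conjugate. Conditions at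
  the exponents \<open>s - j\<close> thus control the whole window around \<open>s\<close>.\<close>

lemma wcoef_dual: "t + t' = 2 * s \<Longrightarrow> \<sigma> t' (wcoef t xs zs) = wcoef t' xs zs"
proof (induction xs arbitrary: zs)
  case (Cons x xs)
  have "\<sigma> t' (\<sigma> t y) = y" for y using Cons.prems sigma_2s[of y] by (simp add: sigma_sigma add.commute)
  then show ?case using Cons by (simp add: sigma_add sigma_mult ac_simps)
qed simp

lemma qcoefs_wcoef: "0 < j \<Longrightarrow> qcoefs j xs zs = wcoef (s - j) xs zs"
  by (induction xs arbitrary: zs) (auto simp: qcoef_def)

lemma qcoefs_0: "qcoefs 0 xs zs + \<sigma> s (qcoefs 0 xs zs) = wcoef s xs zs"
proof (induction xs arbitrary: zs)
  case (Cons x xs)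
  then show ?case using Cons[of "tl zs", symmetric] by (simp add: qcoef_def sigma_add sigma_mult ac_simps)
qed simp

text \<open>As \<open>a 0\<close> runs only through a subfield, its condition is weaker than the
  vanishing of \<open>qcoefs 0\<close>; it is exactly the vanishing of the middle coefficient at
  exponent \<open>s\<close>.\<close>

lemma orthogonal_iff_wkernel:
  assumes "length xs < k" "length zs = length xs"
  shows "(\<forall>j<k. if j = 0 then qcoefs 0 xs zs + \<sigma> s (qcoefs 0 xs zs) = 0 else qcoefs j xs zs = 0)
    \<longleftrightarrow> zs \<in> wkernel xs"
proof
  assume h: "\<forall>j<k. if j = 0 then qcoefs 0 xs zs + \<sigma> s (qcoefs 0 xs zs) = 0 else qcoefs j xs zs = 0"
  have "wcoef t xs zs = 0" if t: "s - k < t" "t < s + k" for t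
  proof -
    consider "t = s" | "t < s" | "t > s" by linarith
    then show ?thesis
    proof cases
      case 1
      then show ?thesis using h[rule_format, of 0] k_pos qcoefs_0 by simp
    next
      case 2
      then show ?thesis using h[rule_format, of "s - t"] t qcoefs_wcoef[of "s - t" xs zs] k_le by simp
    next
      case 3
      then have "qcoefs (t - s) xs zs = 0" using h[rule_format, of "t - s"] t by simp
      then have "wcoef (s - (t - s)) xs zs = 0" using qcoefs_wcoef[of "t - s"] 3 by simp
      then show ?thesis using wcoef_dual[of "s - (t - s)" t xs zs] 3 t k_le by simp
    qed
  qed
  then show "zs \<in> wkernel xs"
    using assms wedge_zero_if_wcoef_zero by (auto simp: wkernel_def)
next
  assume "zs \<in> wkernel xs"
  then have "wcoef t xs zs = 0" if "t < 2 * s" for t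
    using that wcoef_zero_if_wedge_zero by (auto simp: wkernel_def)
  then show "\<forall>j<k. if j = 0 then qcoefs 0 xs zs + \<sigma> s (qcoefs 0 xs zs) = 0 else qcoefs j xs zs = 0"
    using qcoefs_wcoef[of _ xs zs] s_pos by (auto simp: qcoefs_0)
qed

text \<open>The sum of \<open>\<psi> (linpair a xs zs)\<close> in two orders: summing over
  \<open>zs\<close> detects \<open>xs\<close> inside the radical, summing over \<open>Y\<close>
  detects \<open>zs\<close> in \<open>wkernel xs\<close>.\<close>

lemma card_forms_with_radical:
  assumes "indep xs" "length xs < k"
  shows "card {a \<in> Y. set xs \<subseteq> rad a} * 2 ^ (m * length xs) = card Y * q ^ (Suc (length xs) choose 2)"
proof -
  let ?Z = "{zs :: 'a list. length zs = length xs}"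
  have finZ: "finite ?Z" by (rule finite_lists_length_UNIV)
  have Y0: "a 0 \<in> subF (2 ^ n)" if "a \<in> Y" for a
    using that by (rule Y_0)
  have inner: "(\<Sum>a\<in>Y. \<psi> (linpair a xs zs)) = (if zs \<in> wkernel xs then int (card Y) else 0)" if zs: "zs \<in> ?Z" for zs
  proof -
    have "(\<Sum>a\<in>Y. \<psi> (linpair a xs zs)) = (\<Sum>a\<in>Y. \<Prod>j<k. \<psi> (a j * qcoefs j xs zs))"
      using Y0 psi_linpair by (intro sum.cong) auto
    also have "\<dots> = (\<Prod>j<k. \<Sum>c\<in>coef_dom j. \<psi> (c * qcoefs j xs zs))"
      unfolding Y_def by (rule prod_sum_PiE[symmetric]) auto
    also have "\<dots> = (\<Prod>j<k. if (if j = 0 then qcoefs 0 xs zs + \<sigma> s (qcoefs 0 xs zs) = 0 else qcoefs j xs zs = 0)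
        then int (card (coef_dom j)) else 0)"
      by (rule prod.cong) (auto simp: coef_dom_def sum_psi_subF_n sum_psi_right card_field)
    also have "\<dots> = (if zs \<in> wkernel xs then (\<Prod>j<k. int (card (coef_dom j))) else 0)"
    proof (cases "zs \<in> wkernel xs")
      case True
      then show ?thesis using orthogonal_iff_wkernel[of xs zs] zs assms by (auto intro!: prod.cong)
    next
      case False
      then obtain j where "j < k" "\<not> (if j = 0 then qcoefs 0 xs zs + \<sigma> s (qcoefs 0 xs zs) = 0 else qcoefs j xs zs = 0)"
        using orthogonal_iff_wkernel[of xs zs] zs assms by auto
      then show ?thesis using False by (auto intro!: prod_zero bexI[of _ j])
    qed
    also have "(\<Prod>j<k. int (card (coef_dom j))) = int (card Y)" by (simp add: Y_def card_PiE)
    finally show ?thesis .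
  qed
  have "int (card {a \<in> Y. set xs \<subseteq> rad a} * 2 ^ (m * length xs))
      = (\<Sum>a\<in>Y. if set xs \<subseteq> rad a then 2 ^ (m * length xs) else 0)"
    using finite_Y by (simp add: sum.If_cases Int_def)
  also have "\<dots> = (\<Sum>a\<in>Y. \<Sum>zs\<in>?Z. \<psi> (linpair a xs zs))"
    by (intro sum.cong) (auto simp: sum_psi_linpair rad_def)
  also have "\<dots> = (\<Sum>zs\<in>?Z. \<Sum>a\<in>Y. \<psi> (linpair a xs zs))" by (rule sum.swap)
  also have "\<dots> = (\<Sum>zs\<in>?Z. if zs \<in> wkernel xs then int (card Y) else 0)"
    using inner by (intro sum.cong) auto
  also have "\<dots> = (\<Sum>zs\<in>wkernel xs. int (card Y))"
    using finZ by (subst sum.inter_filter[symmetric]) (auto intro!: sum.cong simp: wkernel_def)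
  also have "\<dots> = int (card Y * q ^ (Suc (length xs) choose 2))"
    using card_wkernel[OF assms(1)] by simp
  finally show ?thesis by linarith
qed

text \<open>Counts pairs of a tuple and an independent list of length \<open>u\<close> in its
  radical, in both orders.\<close>

lemma radical_moments:
  assumes "u < k"
  shows "(\<Sum>a\<in>Y. \<Prod>i<u. real (card (rad a)) - real q ^ i)
    = real (card Y) * (real q ^ (Suc u choose 2) * (\<Prod>i<u. real q ^ (2 * s) - real q ^ i) / real q ^ (2 * s * u))"
proof -
  let ?I = "{xs :: 'a list. length xs = u \<and> indep xs}"
  have finI: "finite ?I" by (rule finite_subset[OF _ finite_lists_length_UNIV[of u]]) auto
  have U: "subspace UNIV" by (auto simp: subspace_def)
  have "(\<Sum>a\<in>Y. \<Prod>i<u. real (card (rad a)) - real q ^ i)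
      = (\<Sum>a\<in>Y. real (card {xs. length xs = u \<and> set xs \<subseteq> rad a \<and> indep xs}))"
    by (simp add: card_indep_lists[OF subspace_rad])
  also have "\<dots> = (\<Sum>a\<in>Y. \<Sum>xs\<in>{xs\<in>?I. set xs \<subseteq> rad a}. 1)"
  proof (intro sum.cong refl)
    fix a
    have "{xs. length xs = u \<and> set xs \<subseteq> rad a \<and> indep xs} = {xs\<in>?I. set xs \<subseteq> rad a}" by blast
    then show "real (card {xs. length xs = u \<and> set xs \<subseteq> rad a \<and> indep xs}) = (\<Sum>xs\<in>{xs\<in>?I. set xs \<subseteq> rad a}. 1)"
      by (simp only: sum_constant mult_1_right)
  qed
  also have "\<dots> = (\<Sum>xs\<in>?I. \<Sum>a\<in>{a\<in>Y. set xs \<subseteq> rad a}. 1)"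
    by (rule sum.swap_restrict[OF finite_Y finI])
  also have "\<dots> = (\<Sum>xs\<in>?I. real (card Y) * real q ^ (Suc u choose 2) / real q ^ (2 * s * u))"
  proof (rule sum.cong)
    fix xs assume xs: "xs \<in> ?I"
    have "2 ^ m = q ^ (2 * s)" using card_field_q by (simp add: card_field)
    then have "card {a \<in> Y. set xs \<subseteq> rad a} * q ^ (2 * s * u) = card Y * q ^ (Suc u choose 2)"
      using card_forms_with_radical[of xs] xs assms by (simp add: power_mult)
    then have "real (card {a \<in> Y. set xs \<subseteq> rad a}) * real q ^ (2 * s * u) = real (card Y) * real q ^ (Suc u choose 2)"
      unfolding of_nat_mult[symmetric] of_nat_power[symmetric] by (simp only:)
    then show "(\<Sum>a\<in>{a\<in>Y. set xs \<subseteq> rad a}. 1) = real (card Y) * real q ^ (Suc u choose 2) / real q ^ (2 * s * u)"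
      using q_ge_2 by (simp add: field_simps)
  qed simp
  also have "\<dots> = real (card ?I) * (real (card Y) * real q ^ (Suc u choose 2) / real q ^ (2 * s * u))" by simp
  also have "real (card ?I) = (\<Prod>i<u. real q ^ (2 * s) - real q ^ i)"
    using card_indep_lists[OF U, of u] by (simp add: card_field_q)
  finally show ?thesis by simp
qed

text \<open>Splits off a hyperbolic plane spanned by \<open>x\<close> and \<open>y\<close> with
  \<open>B x y = 1\<close>; its orthogonal complement \<open>?V2\<close> is smaller by the factor
  \<open>q\<^sup>2\<close> and has the same radical.\<close>

lemma card_alternating_radical:
  fixes B :: "'a \<Rightarrow> 'a \<Rightarrow> 'a"
  assumes B: "\<And>x y z. B (x + y) z = B x z + B y z" "\<And>x y z. B x (y + z) = B x y + B x z"
    "\<And>c x y. c \<in> Fq \<Longrightarrow> B (c * x) y = c * B x y" "\<And>c x y. c \<in> Fq \<Longrightarrow> B x (c * y) = c * B x y"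
    "\<And>x y. B x y \<in> Fq" "\<And>x. B x x = 0"
  shows "subspace V \<Longrightarrow> \<exists>i. card V = q ^ (2 * i) * card {v\<in>V. \<forall>w\<in>V. B v w = 0}"
proof (induction "card V" arbitrary: V rule: less_induct)
  case less
  have sym: "B x y = B y x" for x y
  proof -
    have "B (x + y) (x + y) = B x y + B y x" by (subst B(1)) (simp add: B(2,6))
    then show ?thesis by (simp add: B(6) add_eq_0)
  qed
  show ?case
  proof (cases "\<forall>v\<in>V. \<forall>w\<in>V. B v w = 0")
    case True
    then have "{v\<in>V. \<forall>w\<in>V. B v w = 0} = V" by blast
    then show ?thesis by (intro exI[of _ 0]) simp
  next
    case False
    then obtain x y1 where xy1: "x \<in> V" "y1 \<in> V" "B x y1 \<noteq> 0" by blast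
    define y where "y = inverse (B x y1) * y1"
    have "inverse (B x y1) \<in> Fq" by (rule subF_inverse[OF B(5)])
    then have y: "y \<in> V" using xy1 less.prems by (simp add: y_def subspace_def)
    have Bxy: "B x y = 1" using xy1 B(4)[OF subF_inverse[OF B(5)]] by (simp add: y_def)
    have Byx: "B y x = 1" using Bxy sym by simp
    let ?V1 = "{v\<in>V. B x v = 0}" and ?V2 = "{v\<in>V. B x v = 0 \<and> B y v = 0}"
    have cl: "\<And>u v. u \<in> V \<Longrightarrow> v \<in> V \<Longrightarrow> u + v \<in> V" "\<And>c u. c \<in> Fq \<Longrightarrow> u \<in> V \<Longrightarrow> c * u \<in> V"
      using less.prems by (auto simp: subspace_def)
    have zc: "B x 0 = 0" for x using B(2)[of x 0 0] by simp
    have "card V = card (B x ` V) * card ?V1"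
      by (rule card_additive_kernel) (use cl in \<open>auto simp: B(2)\<close>)
    moreover have "B x ` V = Fq"
    proof
      show "Fq \<subseteq> B x ` V"
      proof
        fix c assume "c \<in> Fq"
        then show "c \<in> B x ` V" using y cl(2) Bxy by (intro image_eqI[where x = "c * y"]) (simp_all add: B(4))
      qed
    qed (auto simp: B(5))
    moreover have "card ?V1 = card (B y ` ?V1) * card {v\<in>?V1. B y v = 0}"
      by (rule card_additive_kernel) (use cl in \<open>auto simp: B(2)\<close>)
    moreover have "B y ` ?V1 = Fq"
    proof
      show "Fq \<subseteq> B y ` ?V1"
      proof
        fix c assume "c \<in> Fq"
        then show "c \<in> B y ` ?V1"
          using xy1(1) cl(2) Byx by (intro image_eqI[where x = "c * x"]) (simp_all add: B(4,6))
      qed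
    qed (auto simp: B(5))
    moreover have "{v\<in>?V1. B y v = 0} = ?V2" by auto
    ultimately have cardV: "card V = q\<^sup>2 * card ?V2" by (simp add: card_Fq power2_eq_square)
    have sub2: "subspace ?V2"
      using less.prems by (auto simp: subspace_def B(2,4) zc)
    have "card V \<noteq> 0" using xy1(1) by auto
    then have "0 < card ?V2" using cardV by (metis gr0I mult_0_right)
    moreover have "1 < q\<^sup>2" using q_ge_2 by (intro one_less_power) auto
    ultimately have "card ?V2 < card V" by (simp only: cardV) simp
    from less.hyps[OF this sub2] obtain i where
      i: "card ?V2 = q ^ (2 * i) * card {v\<in>?V2. \<forall>w\<in>?V2. B v w = 0}" by blast
    have "{v\<in>?V2. \<forall>w\<in>?V2. B v w = 0} = {v\<in>V. \<forall>w\<in>V. B v w = 0}"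
    proof (intro set_eqI iffI)
      fix v assume v: "v \<in> {v\<in>?V2. \<forall>w\<in>?V2. B v w = 0}"
      have "B v w = 0" if w: "w \<in> V" for w
      proof -
        \<comment> \<open>The component of \<open>w\<close> orthogonal to \<open>x\<close> and
          \<open>y\<close>; the part removed is invisible to \<open>v\<close>.\<close>
        define w' where "w' = w + (B y w * x + B x w * y)"
        have "w' \<in> V" using w cl xy1 y B(5) by (simp add: w'_def)
        moreover have "B x w' = 0" "B y w' = 0" using Bxy Byx by (simp_all add: w'_def B(2,4,5,6))
        ultimately have "B v w' = 0" using v by auto
        moreover have "B v x = 0" "B v y = 0" using v sym[of v x] sym[of v y] by simp_all
        ultimately show ?thesis by (simp add: w'_def B(2,4,5))
      qed
      then show "v \<in> {v\<in>V. \<forall>w\<in>V. B v w = 0}" using v by auto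
    next
      fix v assume "v \<in> {v\<in>V. \<forall>w\<in>V. B v w = 0}"
      then show "v \<in> {v\<in>?V2. \<forall>w\<in>?V2. B v w = 0}" using xy1(1) y sym[of x v] sym[of y v] by simp
    qed
    then have "card V = q ^ (2 * Suc i) * card {v\<in>V. \<forall>w\<in>V. B v w = 0}"
      using cardV i by (simp add: power_add power2_eq_square)
    then show ?thesis by blast
  qed
qed

text \<open>The form is alternating: on the diagonal the terms with \<open>0 < j\<close> cancel, and
  the term at \<open>0\<close> is fixed by \<open>\<sigma> s\<close>, so \<open>T\<close> adds each
  of its conjugates twice. Hence the radical has even dimension.\<close>

lemma card_rad:
  assumes a: "a \<in> Y"
  shows "\<exists>j\<le>s. card (rad a) = q ^ (2 * j)"
proof -
  have a0: "a 0 \<in> subF (2 ^ n)" using a by (rule Y_0)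
  define B where "B x y = T (y * lin a x)" for x y
  have T0: "T y = 0" if "\<sigma> s y = y" for y
  proof -
    have "T y = (\<Sum>t<s. \<sigma> t y) + (\<Sum>t\<in>{s..<s + s}. \<sigma> t y)"
      unfolding T_def mult_2 by (subst sum.union_disjoint[symmetric]) (auto intro: sum.cong)
    also have "(\<Sum>t\<in>{s..<s + s}. \<sigma> t y) = (\<Sum>t<s. \<sigma> (t + s) y)"
      using sum.shift_bounds_nat_ivl[of "\<lambda>t. \<sigma> t y" 0 s s] by (simp add: lessThan_atLeast0)
    also have "\<dots> = (\<Sum>t<s. \<sigma> t y)" using that by (simp add: sigma_sigma[symmetric])
    finally show ?thesis by simp
  qed
  have "B x x = 0" for x
  proof -
    have "B x x = (\<Sum>j<k. T (a j * qcoef j x x))"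
      unfolding B_def by (rule pairing[of a, OF a0]) (auto simp: T_add T_sigma)
    also have "\<dots> = 0"
    proof (rule sum.neutral, intro ballI)
      fix j
      have "\<sigma> s (a 0 * (x * \<sigma> s x)) = a 0 * (x * \<sigma> s x)"
        using a0 by (simp add: sigma_mult subF_n ac_simps)
      then show "T (a j * qcoef j x x) = 0" using T0 by (auto simp: qcoef_def)
    qed
    finally show ?thesis .
  qed
  then have "\<exists>i. card (UNIV :: 'a set) = q ^ (2 * i) * card {v\<in>UNIV. \<forall>w\<in>UNIV. B v w = 0}"
  proof (intro card_alternating_radical)
    show "B (c * x) y = c * B x y" "B x (c * y) = c * B x y" if "c \<in> Fq" for c x y
      using T_scale[OF that, of "y * lin a x"] that by (simp_all add: B_def lin_scale ac_simps)
  qed (auto simp: B_def lin_add distrib_left distrib_right T_add T_Fq subspace_def)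
  moreover have "{v\<in>UNIV. \<forall>w\<in>UNIV. B v w = 0} = rad a"
  proof (intro set_eqI iffI)
    fix x assume "x \<in> {v\<in>UNIV. \<forall>w\<in>UNIV. B v w = 0}"
    then have "T (lin a x * y) = 0" for y by (simp add: B_def mult.commute)
    then show "x \<in> rad a" using T_nondegenerate by (simp add: rad_def)
  qed (auto simp: B_def rad_def)
  ultimately obtain i where i: "q ^ (2 * s) = q ^ (2 * i) * card (rad a)" by (auto simp: card_field_q)
  have "0 < card (rad a)" using subspace_rad[of a] by (auto simp: subspace_def card_gt_0_iff)
  then have "q ^ (2 * i) \<le> q ^ (2 * s)" unfolding i by (simp add: Suc_leI)
  then have le: "i \<le> s" using q_ge_2 by (simp add: power_increasing_iff)
  then have "q ^ (2 * s) = q ^ (2 * i) * q ^ (2 * (s - i))"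
    by (simp add: power_add[symmetric] add_mult_distrib2[symmetric])
  then have "card (rad a) = q ^ (2 * (s - i))" using i q_ge_2 by simp
  then show ?thesis by (intro exI[of _ "s - i"]) simp
qed

text \<open>The exponents of \<open>lin a\<close> are \<open>s - k + 1..s + k - 1\<close>; rotation
  by \<open>s + k - 1\<close> moves them to \<open>0..2 * k - 2\<close>.\<close>

lemma card_rad_le:
  assumes nz: "j < k" "a j \<noteq> 0"
  shows "card (rad a) \<le> q ^ (2 * (k - 1))"
proof -
  define l where "l t = (if t = s then a 0 else if s - k < t \<and> t < s then a (s - t)
    else if s < t \<and> t < s + k then \<sigma> t (a (t - s)) else 0)" for t
  have "lin a x = (\<Sum>t<2 * s. l t * \<sigma> t x)" for x
  proof -
    have "(\<Sum>t<2 * s. l t * \<sigma> t x) = (\<Sum>t\<in>insert s ({s - k<..<s} \<union> {s<..<s + k}). l t * \<sigma> t x)"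
      using s_pos k_le by (intro sum.mono_neutral_right) (auto simp: l_def)
    also have "\<dots> = l s * \<sigma> s x + ((\<Sum>t\<in>{s - k<..<s}. l t * \<sigma> t x) + (\<Sum>t\<in>{s<..<s + k}. l t * \<sigma> t x))"
      by (subst sum.insert) (auto intro!: sum.union_disjoint)
    also have "(\<Sum>t\<in>{s - k<..<s}. l t * \<sigma> t x) = (\<Sum>j\<in>{1..<k}. a j * \<sigma> (s - j) x)"
      by (rule sum.reindex_bij_witness[where i = "\<lambda>j. s - j" and j = "\<lambda>t. s - t"])
        (use k_le in \<open>auto simp: l_def\<close>)
    also have "(\<Sum>t\<in>{s<..<s + k}. l t * \<sigma> t x) = (\<Sum>j\<in>{1..<k}. \<sigma> (s + j) (a j * x))"
      by (rule sum.reindex_bij_witness[where i = "\<lambda>j. s + j" and j = "\<lambda>t. t - s"])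
        (auto simp: l_def sigma_mult)
    finally show ?thesis by (simp add: lin_def l_def sum.distrib)
  qed
  moreover have "card {x. (\<Sum>t<2 * s. l t * \<sigma> t x) = 0} \<le> q ^ (2 * (k - 1))"
  proof (rule card_window_roots[where r = "s + k - 1"])
    show "2 * (k - 1) < 2 * s" using k_pos k_le by simp
    show "\<exists>t<2 * s. l t \<noteq> 0"
      using nz k_le s_pos by (intro exI[of _ "s - j"]) (cases "j = 0"; auto simp: l_def)
    fix t assume "t < 2 * s" "l t \<noteq> 0"
    then have t: "s - k < t" "t < s + k" using k_pos k_le by (auto simp: l_def split: if_splits)
    then have "t + (s + k - 1) = (t - (s - k + 1)) + 2 * s" using k_pos k_le by simp
    then have "(t + (s + k - 1)) mod (2 * s) = (t - (s - k + 1)) mod (2 * s)" by simp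
    also have "\<dots> \<le> t - (s - k + 1)" by simp
    finally show "(t + (s + k - 1)) mod (2 * s) \<le> 2 * (k - 1)" using t k_pos k_le by simp
  qed
  ultimately show ?thesis by (simp add: rad_def)
qed

section \<open>Exponential sums and the distribution of radicals\<close>

definition qform :: "(nat \<Rightarrow> 'a) \<Rightarrow> 'a \<Rightarrow> 'a" where
  "qform a x = trn (a 0 * (x * \<sigma> s x)) + (\<Sum>j\<in>{1..<k}. tr (a j * (x * \<sigma> (s - j) x)))"

definition chr :: "(nat \<Rightarrow> 'a) \<Rightarrow> 'a \<Rightarrow> 'a \<Rightarrow> int" where
  "chr a b x = sgn2 (qform a x) * \<psi> (b * x)"

definition S :: "(nat \<Rightarrow> 'a) \<Rightarrow> 'a \<Rightarrow> int" where
  "S a b = (\<Sum>x\<in>UNIV. chr a b x)"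

lemma qform_0 [simp]: "qform a 0 = 0"
  by (simp add: qform_def)

text \<open>At index \<open>0\<close> the two mixed products are conjugate under
  \<open>\<sigma> s\<close>, so \<open>trn\<close> of their sum is \<open>tr\<close> of one of
  them.\<close>

lemma qform_add:
  assumes a: "a 0 \<in> subF (2 ^ n)"
  shows "qform a (x + y) = qform a x + qform a y + tr (x * lin a y)"
proof -
  have "tr (x * lin a y) = (\<Sum>j<k. tr (a j * qcoef j y x))"
    by (rule pairing[of a, OF a]) (auto simp: tr_add tr_sigma)
  also have "\<dots> = tr (a 0 * (y * \<sigma> s x)) + (\<Sum>j\<in>{1..<k}. tr (a j * (y * \<sigma> (s - j) x + x * \<sigma> (s - j) y)))"
    unfolding lessThan_k by (subst sum.insert) (auto simp: qcoef_def intro!: sum.cong)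
  also have "tr (a 0 * (y * \<sigma> s x)) = trn (a 0 * (y * \<sigma> s x)) + trn (a 0 * (x * \<sigma> s y))"
    using a by (simp add: trn_norm[symmetric] trn_add[symmetric] sigma_mult subF_n ac_simps)
  finally show ?thesis
    by (simp add: qform_def sigma_add distrib_left distrib_right trn_add tr_add sum.distrib ac_simps)
qed

lemma trn_subF: assumes "y \<in> subF (2 ^ n)" shows "trn y \<in> subF (2 ^ 1)"
proof -
  have "trn y ^ 2 + y = (\<Sum>i<Suc n. y ^ (2 ^ i))"
    unfolding sum.lessThan_Suc_shift trn_def frob_sum[where t = 1, unfolded power_one_right]
    by (simp add: power_mult[symmetric] mult.commute)
  also have "\<dots> = trn y + y" using assms by (simp add: trn_def subF_def)
  finally show ?thesis by (simp add: subF_def)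
qed

lemma qform_subF:
  assumes a: "a 0 \<in> subF (2 ^ n)"
  shows "qform a x \<in> subF (2 ^ 1)"
proof -
  have "x * \<sigma> s x \<in> subF (2 ^ n)" by (simp add: subF_n sigma_mult mult.commute)
  then show ?thesis unfolding qform_def
    by (intro subF_add subF_sum trn_subF[OF subF_mult[OF a]] tr_subF)
qed

lemma qform_add_left:
  "qform (\<lambda>j. a j + a' j) x = qform a x + qform a' x"
  by (simp add: qform_def distrib_right trn_add tr_add sum.distrib add.assoc add.left_commute)

lemma chr_add:
  assumes a: "a 0 \<in> subF (2 ^ n)"
  shows "chr a b (x + y) = chr a b x * chr a b y * \<psi> (x * lin a y)"
proof -
  have m: "qform a z \<in> subF (2 ^ 1)" for z by (rule qform_subF[of a, OF a])
  show ?thesis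
    unfolding chr_def qform_add[of a, OF a] distrib_left psi_add
      sgn2_add[OF subF_add[OF m m] tr_subF] sgn2_add[OF m m]
    by (simp add: \<psi>_def)
qed

lemma chr_square: "chr a b x * chr a b x = 1"
  by (simp add: chr_def \<psi>_def sgn2_def)

text \<open>After the shift \<open>y \<mapsto> x + y\<close>, the sum over \<open>x\<close> leaves
  only those \<open>y\<close> with \<open>lin a y = 0\<close>.\<close>

lemma S_square:
  assumes a: "a 0 \<in> subF (2 ^ n)"
  shows "(S a b)\<^sup>2 = 2 ^ m * (\<Sum>y\<in>rad a. chr a b y)"
proof -
  have "(S a b)\<^sup>2 = (\<Sum>x\<in>UNIV. chr a b x * (\<Sum>y\<in>UNIV. chr a b y))"
    by (simp add: S_def power2_eq_square sum_distrib_right)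
  also have "\<dots> = (\<Sum>x\<in>UNIV. chr a b x * (\<Sum>y\<in>UNIV. chr a b (x + y)))"
  proof (rule sum.cong[OF refl])
    fix x
    have "(\<Sum>y\<in>UNIV. chr a b y) = (\<Sum>y\<in>UNIV. chr a b (x + y))"
      by (rule sum.reindex_bij_witness[where i = "\<lambda>y. x + y" and j = "\<lambda>y. x + y"]) auto
    then show "chr a b x * (\<Sum>y\<in>UNIV. chr a b y) = chr a b x * (\<Sum>y\<in>UNIV. chr a b (x + y))"
      by (rule arg_cong)
  qed
  also have "\<dots> = (\<Sum>x\<in>UNIV. \<Sum>y\<in>UNIV. chr a b y * \<psi> (x * lin a y))"
    by (simp add: sum_distrib_left chr_add[of a, OF a] mult.assoc[symmetric] chr_square)
  also have "\<dots> = (\<Sum>y\<in>UNIV. chr a b y * (\<Sum>x\<in>UNIV. \<psi> (x * lin a y)))"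
    by (subst sum.swap) (simp add: sum_distrib_left)
  also have "\<dots> = (\<Sum>y\<in>UNIV. if y \<in> rad a then 2 ^ m * chr a b y else 0)"
    by (intro sum.cong) (auto simp: sum_psi_right rad_def)
  finally show ?thesis by (simp add: sum.If_cases sum_distrib_left)
qed

text \<open>On the radical the polar form vanishes, so \<open>chr a b\<close> is a character there
  and its sum is zero or the full size.\<close>

lemma S_square_cases:
  assumes a: "a 0 \<in> subF (2 ^ n)"
  shows "(S a b)\<^sup>2 = 0 \<or> (S a b)\<^sup>2 = 2 ^ m * int (card (rad a))"
proof -
  have "(\<Sum>y\<in>rad a. chr a b y) = (if \<forall>y\<in>rad a. chr a b y = 1 then int (card (rad a)) else 0)"
    by (rule sum_sign_character) (auto simp: rad_def lin_add chr_add[of a, OF a])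
  then show ?thesis by (simp add: S_square[of a, OF a])
qed

lemma sum_S: "(\<Sum>b\<in>UNIV. S a b) = 2 ^ m"
proof -
  have "(\<Sum>b\<in>UNIV. S a b) = (\<Sum>x\<in>UNIV. sgn2 (qform a x) * (\<Sum>b\<in>UNIV. \<psi> (b * x)))"
    unfolding S_def chr_def by (subst sum.swap) (simp add: sum_distrib_left)
  also have "\<dots> = (\<Sum>x\<in>UNIV. if x = 0 then 2 ^ m * sgn2 (qform a x) else 0)"
    by (intro sum.cong) (auto simp: sum_psi_right)
  finally show ?thesis by (simp add: sgn2_def)
qed

lemma sum_S_square:
  assumes a: "a 0 \<in> subF (2 ^ n)"
  shows "(\<Sum>b\<in>UNIV. (S a b)\<^sup>2) = 2 ^ m * 2 ^ m"
proof -
  have "(\<Sum>b\<in>UNIV. (S a b)\<^sup>2) = 2 ^ m * (\<Sum>b\<in>UNIV. \<Sum>y\<in>rad a. chr a b y)"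
    by (simp add: S_square[of a, OF a] sum_distrib_left)
  also have "(\<Sum>b\<in>UNIV. \<Sum>y\<in>rad a. chr a b y) = (\<Sum>y\<in>rad a. sgn2 (qform a y) * (\<Sum>b\<in>UNIV. \<psi> (b * y)))"
    unfolding chr_def by (subst sum.swap) (simp add: sum_distrib_left)
  also have "\<dots> = (\<Sum>y\<in>rad a. if y = 0 then 2 ^ m * sgn2 (qform a y) else 0)"
    by (intro sum.cong) (auto simp: sum_psi_right)
  also have "\<dots> = 2 ^ m"
    by (simp add: sgn2_def rad_def)
  finally show ?thesis .
qed

lemma mn: "m = n + n"
  by (simp add: m_eq n_eq)

lemma S_values:
  assumes a: "a 0 \<in> subF (2 ^ n)" and r: "card (rad a) = q ^ (2 * j)"
  shows "S a b = 0 \<or> S a b = 2 ^ (n + e * j) \<or> S a b = - (2 ^ (n + e * j))"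
proof -
  have "2 ^ m * int (card (rad a)) = (2 ^ (n + e * j))\<^sup>2"
  proof -
    have "m + e * (2 * j) = (n + e * j) * 2" by (simp add: mn)
    then show ?thesis by (simp only: r q_def power_mult[symmetric] of_nat_power of_nat_numeral power_add[symmetric])
  qed
  then have "(S a b)\<^sup>2 = 0 \<or> (S a b)\<^sup>2 = (2 ^ (n + e * j))\<^sup>2"
    using S_square_cases[of a, OF a] by simp
  then show ?thesis by (auto simp: power2_eq_iff)
qed

lemma card_S_eq:
  assumes a: "a 0 \<in> subF (2 ^ n)" and r: "card (rad a) = q ^ (2 * j)" and j: "j \<le> s"
    and \<epsilon>: "\<epsilon> = 1 \<or> \<epsilon> = -1"
  shows "real (card {b. S a b = \<epsilon> * 2 ^ (n + e * j)}) = 1/2 * (2 ^ (m - 2 * e * j) + of_int \<epsilon> * 2 ^ (n - e * j))"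
proof -
  define R :: int where "R = 2 ^ (n + e * j)"
  define P where "P = {b. S a b = R}"
  define M where "M = {b. S a b = - R}"
  have R: "0 < R" by (simp add: R_def)
  have val: "S a b = 0 \<or> S a b = R \<or> S a b = - R" for b
    using S_values[of a, OF a r] by (simp add: R_def)
  have "S a b = R * (if b \<in> P then 1 else 0) - R * (if b \<in> M then 1 else 0)" for b
    using val[of b] R by (auto simp: P_def M_def)
  then have "(\<Sum>b\<in>UNIV. S a b) = R * int (card P) - R * int (card M)"
    by (simp add: sum_subtractf sum_distrib_left[symmetric] sum.If_cases)
  then have e1: "R * (int (card P) - int (card M)) = 2 ^ m"
    by (simp add: sum_S right_diff_distrib)
  have "(S a b)\<^sup>2 = R\<^sup>2 * (if b \<in> P then 1 else 0) + R\<^sup>2 * (if b \<in> M then 1 else 0)" for b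
    using val[of b] R by (auto simp: P_def M_def)
  then have "(\<Sum>b\<in>UNIV. (S a b)\<^sup>2) = R\<^sup>2 * int (card P) + R\<^sup>2 * int (card M)"
    by (simp add: sum.distrib sum_distrib_left[symmetric] sum.If_cases)
  then have e2: "R\<^sup>2 * (int (card P) + int (card M)) = 2 ^ m * 2 ^ m"
    using sum_S_square[of a, OF a] by (simp add: distrib_left)
  have ej: "e * j \<le> n" using j by (simp add: n_eq)
  \<comment> \<open>As \<open>m = 2 * n\<close>, dividing the moments by \<open>R\<close> and
    \<open>R\<^sup>2\<close> gives the difference and the sum of the two counts.\<close>
  have "R * 2 ^ (n - e * j) = 2 ^ m" unfolding R_def power_add[symmetric] using ej by (simp add: mn)
  then have f1: "int (card P) - int (card M) = 2 ^ (n - e * j)" using e1 R by (metis mult_left_cancel less_irrefl)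
  have "R\<^sup>2 * 2 ^ (m - 2 * e * j) = 2 ^ m * 2 ^ m"
    unfolding R_def power_add[symmetric] power_mult[symmetric] using ej by (simp add: mn)
  then have f2: "int (card P) + int (card M) = 2 ^ (m - 2 * e * j)" using e2 R
    by (metis mult_left_cancel less_irrefl zero_less_power)
  have "real (card P) - real (card M) = 2 ^ (n - e * j)" "real (card P) + real (card M) = 2 ^ (m - 2 * e * j)"
    using arg_cong[OF f1, of real_of_int] arg_cong[OF f2, of real_of_int] by simp_all
  then show ?thesis using \<epsilon> by (auto simp: P_def M_def R_def)
qed

section \<open>The distribution of the radical exponent\<close>

lemma base_eq: "real q ^ 2 = 4 ^ e"
  by (simp add: q_def power_mult[symmetric] mult.commute[of e]) (simp add: power_mult)

lemma exists_rad_exponent: "\<exists>r. \<forall>a\<in>Y. r a \<le> s \<and> card (rad a) = q ^ (2 * r a)"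
  using card_rad by metis

lemma zero_Y: "restrict (\<lambda>_. 0) {..<k} \<in> Y"
  by (auto simp: Y_def coef_dom_def)

lemma radical_binomial_moments:
  assumes r: "\<And>a. a \<in> Y \<Longrightarrow> card (rad a) = q ^ (2 * r a)" and v: "v < k"
  shows "(\<Sum>a\<in>Y. gauss_binom (4 ^ e) (r a) v) = gauss_binom (4 ^ e) s v * 2 ^ (n * (2 * k - 1 - 2 * v) + e * v)"
proof -
  let ?b = "4 ^ e :: real" and ?Q = "real q"
  have b: "1 < ?b" using e_pos by (simp add: one_less_power)
  have Q: "1 < ?Q" using q_ge_2 by simp
  obtain c where c: "\<And>z. (\<Prod>i<v. z - ?Q ^ (2 * i)) = (\<Sum>u\<le>v. c u * (\<Prod>i<u. z - ?Q ^ i))"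
    "\<And>W. W \<noteq> 0 \<Longrightarrow> (\<Sum>u\<le>v. c u * (?Q ^ (Suc u choose 2) * (\<Prod>i<u. 1 - ?Q ^ i * W)))
      = ?Q ^ v * (\<Prod>i<v. 1 - ?Q ^ (2 * i) * W)"
    using square_base_expansion[of ?Q v] Q by auto
  \<comment> \<open>With this \<open>W\<close>, the moment of index \<open>u\<close> divided by
    \<open>card Y\<close> is the expression to which the second identity for \<open>c\<close>
    applies.\<close>
  define W where "W = 1 / ?Q ^ (2 * s)"
  have W: "W \<noteq> 0" "?Q ^ (2 * s) * W = 1" using Q by (simp_all add: W_def)
  have scale: "(\<Prod>i<u. ?Q ^ (2 * s) - f i) = ?Q ^ (2 * s * u) * (\<Prod>i<u. 1 - f i * W)" for u f
  proof -
    have "?Q ^ (2 * s) - f i = ?Q ^ (2 * s) * (1 - f i * W)" for i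
      using W(2) by (simp add: right_diff_distrib mult.left_commute)
    then show ?thesis by (simp add: prod.distrib power_mult)
  qed
  let ?N = "\<Prod>i<v. ?b ^ v - ?b ^ i"
  have Nz: "?N \<noteq> 0" using b by (auto simp: power_inject_exp)
  have bQ: "?b ^ i = ?Q ^ (2 * i)" for i by (simp add: base_eq[symmetric] power_mult)
  have gb: "gauss_binom ?b i v * ?N = (\<Prod>l<v. ?Q ^ (2 * i) - ?Q ^ (2 * l))" for i
    using gauss_binom_prod[OF b, of i v] by (simp add: bQ)
  have "(\<Sum>a\<in>Y. gauss_binom ?b (r a) v) * ?N = (\<Sum>a\<in>Y. \<Prod>l<v. real (card (rad a)) - ?Q ^ (2 * l))"
    unfolding sum_distrib_right by (intro sum.cong refl) (simp only: gb r of_nat_power)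
  also have "\<dots> = (\<Sum>u\<le>v. c u * (\<Sum>a\<in>Y. \<Prod>i<u. real (card (rad a)) - ?Q ^ i))"
    unfolding c(1) by (subst sum.swap) (simp add: sum_distrib_left)
  also have "\<dots> = (\<Sum>u\<le>v. real (card Y) * (c u * (?Q ^ (Suc u choose 2) * (\<Prod>i<u. 1 - ?Q ^ i * W))))"
  proof (intro sum.cong refl)
    fix u assume "u \<in> {..v}"
    then have "(\<Sum>a\<in>Y. \<Prod>i<u. real (card (rad a)) - ?Q ^ i)
        = real (card Y) * (?Q ^ (Suc u choose 2) * (\<Prod>i<u. 1 - ?Q ^ i * W))"
      using v Q radical_moments[of u] unfolding scale by simp
    then show "c u * (\<Sum>a\<in>Y. \<Prod>i<u. real (card (rad a)) - ?Q ^ i)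
        = real (card Y) * (c u * (?Q ^ (Suc u choose 2) * (\<Prod>i<u. 1 - ?Q ^ i * W)))"
      by (simp add: mult.left_commute)
  qed
  also have "\<dots> = real (card Y) * (?Q ^ v * (\<Prod>i<v. 1 - ?Q ^ (2 * i) * W))"
    by (simp only: sum_distrib_left[symmetric] c(2)[OF W(1)])
  also have "\<dots> = real (card Y) * ?Q ^ v / ?Q ^ (2 * s * v) * (gauss_binom ?b s v * ?N)"
    using Q by (simp add: gb scale)
  finally have "(\<Sum>a\<in>Y. gauss_binom ?b (r a) v) * ?N = (real (card Y) * ?Q ^ v / ?Q ^ (2 * s * v) * gauss_binom ?b s v) * ?N"
    by (simp only: mult.assoc)
  then have "(\<Sum>a\<in>Y. gauss_binom ?b (r a) v) = real (card Y) * ?Q ^ v / ?Q ^ (2 * s * v) * gauss_binom ?b s v"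
    by (rule mult_right_cancel[OF Nz, THEN iffD1])
  \<comment> \<open>Here \<open>card Y = 2 ^ (n * (2 * k - 1))\<close> and
    \<open>?Q ^ (2 * s) = 2 ^ (2 * n)\<close>; \<open>v < k\<close> keeps the subtraction in the
    exponent exact.\<close>
  moreover have "real (card Y) * ?Q ^ v = 2 ^ (n * (2 * k - 1 - 2 * v) + e * v) * ?Q ^ (2 * s * v)"
  proof -
    have "n + m * (k - 1) = n * (2 * k - 1)"
    proof -
      have "2 * k - 1 = 1 + 2 * (k - 1)" using k_pos by simp
      then show ?thesis by (simp only: mn) (simp add: algebra_simps)
    qed
    also have "2 * k - 1 = (2 * k - 1 - 2 * v) + 2 * v" using v by simp
    also have "n * ((2 * k - 1 - 2 * v) + 2 * v) = n * (2 * k - 1 - 2 * v) + e * (2 * s * v)"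
      unfolding distrib_left by (simp add: n_eq)
    finally have "n + m * (k - 1) = n * (2 * k - 1 - 2 * v) + e * (2 * s * v)" .
    then have "real (card Y) = 2 ^ (n * (2 * k - 1 - 2 * v)) * ?Q ^ (2 * s * v)"
      by (simp add: card_Y q_def power_add power_mult)
    then show ?thesis by (simp add: q_def power_add power_mult)
  qed
  ultimately show ?thesis using Q by (simp add: mult.commute)
qed

lemma radical_distribution:
  assumes j: "j < k"
  shows "real (card {a\<in>Y. card (rad a) = q ^ (2 * j)})
    = (\<Sum>v = j..k - 1. (-1) ^ (v - j) * 4 ^ (e * ((v - j) choose 2)) * gauss_binom (4 ^ e) v j
        * gauss_binom (4 ^ e) s v * (2 ^ (n * (2 * k - 1 - 2 * v) + e * v) - 1))"
proof -
  let ?b = "4 ^ e :: real" and ?Q = "real q"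
  have b: "1 < ?b" using e_pos by (simp add: one_less_power)
  have Q: "1 < ?Q" using q_ge_2 by simp
  define a0 :: "nat \<Rightarrow> 'a" where "a0 = restrict (\<lambda>_. 0) {..<k}"
  obtain r where r: "\<And>a. a \<in> Y \<Longrightarrow> r a \<le> s" "\<And>a. a \<in> Y \<Longrightarrow> card (rad a) = q ^ (2 * r a)"
    using exists_rad_exponent by blast
  have req: "card (rad a) = q ^ (2 * i) \<longleftrightarrow> r a = i" if "a \<in> Y" for a i
    using r(2)[OF that] q_ge_2 by (simp add: power_inject_exp)
  have a0: "a0 \<in> Y" by (simp add: a0_def zero_Y)
  have ra0: "r a0 = s"
  proof -
    have "lin a0 x = 0" for x using k_pos by (auto simp: lin_def a0_def)
    then have "card (rad a0) = q ^ (2 * s)" by (simp add: rad_def card_field_q)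
    then show ?thesis using req[OF a0] by blast
  qed
  have lt: "r a < k" if a: "a \<in> Y" "a \<noteq> a0" for a
  proof -
    obtain j' where "j' < k" "a j' \<noteq> 0"
    proof -
      have "\<exists>j'<k. a j' \<noteq> 0"
      proof (rule ccontr)
        assume "\<not> ?thesis"
        then have "a = a0" using a(1) unfolding a0_def Y_def
          by (intro PiE_ext[of _ "{..<k}" "\<lambda>_. UNIV"]) (auto simp: PiE_iff)
        with a(2) show False by simp
      qed
      then show ?thesis using that by blast
    qed
    then have "q ^ (2 * r a) \<le> q ^ (2 * (k - 1))"
      using card_rad_le[of j' a] r(2)[OF a(1)] by simp
    then have "r a \<le> k - 1" using q_ge_2 by (simp add: power_increasing_iff)
    then show ?thesis using k_pos by simp
  qed
  \<comment> \<open>The zero tuple has exponent \<open>s \<ge> k\<close>, outside the triangular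
    system. Removing its contribution \<open>gauss_binom ?b s v\<close> from each moment produces
    the \<open>- 1\<close>.\<close>
  define A where "A i = real (card {a\<in>Y - {a0}. r a = i})" for i
  have Aj: "real (card {a\<in>Y. card (rad a) = q ^ (2 * j)}) = A j"
  proof -
    have "{a\<in>Y. card (rad a) = q ^ (2 * j)} = {a\<in>Y - {a0}. r a = j}"
      using req ra0 j k_le by auto
    then show ?thesis by (simp add: A_def)
  qed
  have mom: "(\<Sum>a\<in>Y. gauss_binom ?b (r a) v) = gauss_binom ?b s v * 2 ^ (n * (2 * k - 1 - 2 * v) + e * v)"
    if "v < k" for v
    by (rule radical_binomial_moments[OF _ that]) (rule r(2))
  have "(\<Sum>i<k. A i * gauss_binom ?b i v)
      = gauss_binom ?b s v * (2 ^ (n * (2 * k - 1 - 2 * v) + e * v) - 1)" if v: "v < k" for v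
  proof -
    have "(\<Sum>a\<in>Y. gauss_binom ?b (r a) v) = gauss_binom ?b s v + (\<Sum>a\<in>Y - {a0}. gauss_binom ?b (r a) v)"
      using a0 finite_Y by (simp add: sum.remove ra0)
    also have "(\<Sum>a\<in>Y - {a0}. gauss_binom ?b (r a) v) = (\<Sum>i<k. \<Sum>a\<in>{a\<in>Y - {a0}. r a = i}. gauss_binom ?b (r a) v)"
      using lt finite_Y by (intro sum.group[symmetric]) auto
    also have "\<dots> = (\<Sum>i<k. A i * gauss_binom ?b i v)"
      by (intro sum.cong) (auto simp: A_def)
    finally show ?thesis using mom[OF v] by (simp add: algebra_simps)
  qed
  then have "A j = (\<Sum>v = j..k - 1. (-1) ^ (v - j) * ?b ^ ((v - j) choose 2) * gauss_binom ?b v j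
        * (gauss_binom ?b s v * (2 ^ (n * (2 * k - 1 - 2 * v) + e * v) - 1)))"
    by (rule gauss_binom_inversion[OF b _ j])
  then show ?thesis unfolding Aj by (simp add: power_mult mult.assoc)
qed

text \<open>Transitivity of the trace, by writing exponents as \<open>i * e + l\<close>. It is an
  identity of power sums, valid also for \<open>y\<close> outside the field with
  \<open>2 ^ (e * r)\<close> elements.\<close>

lemma trace2_trace2: "trace2 e 1 (trace2 (e * r) e y) = (\<Sum>l<e * r. (y :: 'a) ^ (2 ^ l))"
proof -
  have "trace2 e 1 (trace2 (e * r) e y) = (\<Sum>l<e. \<Sum>i<r. y ^ (2 ^ (i * e + l)))"
    using e_pos by (simp add: trace2_def frob_sum frob_frob mult.commute)
  also have "\<dots> = (\<Sum>i<r. \<Sum>l<e. y ^ (2 ^ (i * e + l)))" by (rule sum.swap)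
  also have "\<dots> = (\<Sum>i<r. \<Sum>l\<in>{i * e..<i * e + e}. y ^ (2 ^ l))"
  proof (rule sum.cong[OF refl])
    fix i
    show "(\<Sum>l<e. y ^ (2 ^ (i * e + l))) = (\<Sum>l\<in>{i * e..<i * e + e}. y ^ (2 ^ l))"
      by (rule sum.reindex_bij_witness[where i = "\<lambda>l. l - i * e" and j = "\<lambda>l. i * e + l"]) auto
  qed
  also have "\<dots> = (\<Sum>l<r * e. y ^ (2 ^ l))" by (rule sum.nat_group)
  finally show ?thesis by (simp only: mult.commute)
qed

lemma trace2_trn: "trace2 e 1 (trace2 n e y) = trn y"
  using trace2_trace2[of s y] unfolding n_eq[symmetric] trn_def .

lemma trace2_tr: "trace2 e 1 (trace2 m e y) = tr y"
  using trace2_trace2[of "2 * s" y] unfolding m_eq[symmetric] tr_def .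

lemma trace2_Qfun: "trace2 e 1 (Qfun m n d e k a x) = qform a x + tr (a k * x)"
proof -
  have add: "trace2 e 1 (x + y) = trace2 e 1 x + trace2 e 1 (y :: 'a)" for x y
    by (simp add: trace2_def frob_add sum.distrib)
  have sum: "trace2 e 1 (sum f I) = (\<Sum>i\<in>I. trace2 e 1 (f i :: 'a))" if "finite I" for f and I :: "nat set"
    using that add[of 0 0] by (induction I rule: finite_induct) (simp_all add: add del: One_nat_def)
  have s: "n div e = s" using e_pos by (simp add: n_eq)
  have nd: "n * d div e = d * s" using e_pos by (simp add: n_eq)
  have I: "{1..k - 1} = {1..<k}" using k_pos by auto
  show ?thesis
    unfolding Qfun_def add sum[OF finite_atLeastLessThan] trace2_trn trace2_tr nd s I
    by (simp add: qform_def \<sigma>_def mult.commute[of d])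
qed

section \<open>Codewords\<close>

definition word :: "'a \<Rightarrow> (nat \<Rightarrow> 'a) \<times> 'a \<Rightarrow> bool list" where
  "word \<pi> p = map (\<lambda>i. qform (fst p) (inverse (\<pi> ^ i)) + tr (snd p * inverse (\<pi> ^ i)) \<noteq> 0) [0..<2 ^ m - 1]"

text \<open>\<open>code\<close> takes arbitrary functions as parameters, of which only the values at
  \<open>0..k\<close> matter; pairs in \<open>Y \<times> UNIV\<close> are canonical
  representatives.\<close>

lemma code_eq: "code m n d e k \<pi> = word \<pi> ` (Y \<times> UNIV)"
proof (intro set_eqI iffI)
  fix c assume "c \<in> code m n d e k \<pi>"
  then obtain a where a: "a 0 \<in> subF (2 ^ n)" and c: "c = codeword m n d e k \<pi> a"
    unfolding code_def by blast
  have "restrict a {..<k} \<in> Y" using a by (auto simp: Y_def coef_dom_def)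
  moreover have "qform a x = qform (restrict a {..<k}) x" for x
    using k_pos by (simp add: qform_def)
  then have "c = word \<pi> (restrict a {..<k}, a k)"
    by (simp add: c codeword_def word_def trace2_Qfun[simplified])
  ultimately show "c \<in> word \<pi> ` (Y \<times> UNIV)" by blast
next
  fix c assume "c \<in> word \<pi> ` (Y \<times> UNIV)"
  then obtain a b where a: "a \<in> Y" and c: "c = word \<pi> (a, b)" by auto
  have "qform a x = qform (a(k := b)) x" for x
    using k_pos by (simp add: qform_def)
  then have "c = codeword m n d e k \<pi> (a(k := b))"
    by (simp add: c codeword_def word_def trace2_Qfun[simplified])
  moreover have "(a(k := b)) 0 \<in> subF (2 ^ n)" using Y_0[OF a] k_pos by simp
  ultimately show "c \<in> code m n d e k \<pi>" unfolding code_def by blast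
qed

lemma bij_primitive_powers:
  assumes \<pi>: "primitive_elem (\<pi> :: 'a)"
  shows "bij_betw (\<lambda>i. inverse (\<pi> ^ i)) {..<2 ^ m - 1} (- {0})"
proof -
  have card: "card (- {0 :: 'a}) = 2 ^ m - 1"
    by (simp add: Compl_eq_Diff_UNIV card_field card_Diff_singleton)
  have nz: "\<pi> \<noteq> 0"
  proof
    \<comment> \<open>Since \<open>0 ^ 0 = 1\<close>, zero would be primitive in the field of two
      elements; \<open>m\<close> is at least two here.\<close>
    assume z: "\<pi> = 0"
    have "x = 1" if x: "x \<noteq> 0" for x :: 'a
    proof -
      obtain i where "x = 0 ^ i" using \<pi> x by (auto simp: primitive_elem_def z)
      with x show ?thesis by (cases i) auto
    qed
    then have "- {0 :: 'a} \<subseteq> {1}" by auto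
    then have "card (- {0 :: 'a}) \<le> card {1 :: 'a}" by (intro card_mono) auto
    then have "(2::nat) ^ m \<le> 2 ^ 1" using card by simp
    then have "m \<le> 1" by (rule power_le_imp_le_exp[rotated]) simp
    moreover have "0 < e * s" using e_pos s_pos by simp
    ultimately show False by (simp add: m_eq)
  qed
  have "- {0} \<subseteq> (\<lambda>i. inverse (\<pi> ^ i)) ` {..<2 ^ m - 1}"
  proof
    fix x :: 'a assume "x \<in> - {0}"
    then have "inverse x \<noteq> 0" by simp
    then obtain i where i: "inverse x = \<pi> ^ i" using \<pi> unfolding primitive_elem_def by blast
    have "\<pi> ^ i = \<pi> ^ (i mod (2 ^ m - 1))"
    proof -
      have "\<pi> ^ i = \<pi> ^ ((2 ^ m - 1) * (i div (2 ^ m - 1)) + i mod (2 ^ m - 1))" by simp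
      then show ?thesis by (simp only: power_add power_mult power_card_minus_1[OF nz] power_one mult_1_left)
    qed
    then have "x = inverse (\<pi> ^ (i mod (2 ^ m - 1)))" using i by (metis inverse_inverse_eq)
    moreover have "(1::nat) < 2 ^ m" using m_pos by (intro one_less_power) auto
    then have "i mod (2 ^ m - 1) \<in> {..<2 ^ m - 1}" by simp
    ultimately show "x \<in> (\<lambda>i. inverse (\<pi> ^ i)) ` {..<2 ^ m - 1}" by blast
  qed
  then have im: "(\<lambda>i. inverse (\<pi> ^ i)) ` {..<2 ^ m - 1} = - {0}" using nz by auto
  then have "inj_on (\<lambda>i. inverse (\<pi> ^ i)) {..<2 ^ m - 1}"
    by (intro eq_card_imp_inj_on) (simp_all only: im card, simp_all)
  with im show ?thesis by (simp add: bij_betw_def)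
qed

lemma sgn2_form:
  assumes a: "a 0 \<in> subF (2 ^ n)"
  shows "sgn2 (qform a x + tr (b * x)) = chr a b x"
  unfolding chr_def \<psi>_def by (rule sgn2_add[OF qform_subF[of a, OF a] tr_subF])

text \<open>The \<open>- 1\<close> is the term of the exponential sum at \<open>0\<close>, which no
  power of \<open>\<pi>\<close> reaches.\<close>

lemma DC_word:
  assumes \<pi>: "primitive_elem (\<pi> :: 'a)" and a: "a \<in> Y"
  shows "DC (word \<pi> (a, b)) = S a b - 1"
proof -
  have sign: "(if qform a x + tr (b * x) \<noteq> 0 then - 1 else 1) = chr a b x" for x
    unfolding sgn2_form[of a, OF Y_0[OF a], symmetric] sgn2_def by simp
  have "DC (word \<pi> (a, b)) = (\<Sum>i<2 ^ m - 1. chr a b (inverse (\<pi> ^ i)))"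
    unfolding DC_def word_def map_map o_def fst_conv snd_conv sign interv_sum_list_conv_sum_set_nat
    by (simp only: set_upt lessThan_atLeast0)
  also have "\<dots> = (\<Sum>x\<in>- {0}. chr a b x)"
    by (rule sum.reindex_bij_betw[OF bij_primitive_powers[OF \<pi>]])
  also have "\<dots> = S a b - chr a b 0"
    by (simp add: S_def Compl_eq_Diff_UNIV sum_diff1)
  finally show ?thesis by (simp add: chr_def sgn2_def)
qed

text \<open>The value \<open>2 ^ m\<close> makes the radical the whole field, which
  \<open>card_rad_le\<close> excludes once a coefficient is nonzero.\<close>

lemma S_maximal:
  assumes a: "a 0 \<in> subF (2 ^ n)" and S: "S a b = 2 ^ m" and i: "i < k"
  shows "a i = 0"
proof (rule ccontr)
  assume "a i \<noteq> 0"
  then have "card (rad a) \<le> q ^ (2 * (k - 1))" by (rule card_rad_le[OF i])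
  also have "\<dots> < q ^ (2 * s)" using q_ge_2 k_pos k_le by (intro power_strict_increasing) auto
  finally have lt: "card (rad a) < 2 ^ m" using card_field_q by (simp add: card_field)
  have "(2 ^ m)\<^sup>2 = (2 ^ m :: int) * int (card (rad a))"
    using S_square_cases[of a, OF a, of b] S by simp
  then have "(2 ^ m :: int) = int (card (rad a))" by (simp add: power2_eq_square)
  then show False using lt by (metis less_irrefl of_nat_eq_iff of_nat_numeral of_nat_power)
qed

text \<open>Needed because \<open>alpha\<close> counts words and the moments count parameters. If
  two words agree, the function of the summed parameters is zero everywhere, so its exponential sum
  is \<open>2 ^ m\<close>; that kills the quadratic part, and nondegeneracy of the trace kills the
  linear part.\<close>

lemma inj_word:
  assumes \<pi>: "primitive_elem (\<pi> :: 'a)"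
  shows "inj_on (word \<pi>) (Y \<times> UNIV)"
proof (intro inj_onI; clarify)
  fix a b a' b'
  assume a: "a \<in> Y" "a' \<in> Y" and eq: "word \<pi> (a, b) = word \<pi> (a', b')"
  define a1 where "a1 j = a j + a' j" for j
  have a0: "a 0 \<in> subF (2 ^ n)" "a' 0 \<in> subF (2 ^ n)" "a1 0 \<in> subF (2 ^ n)"
    using a Y_0 by (auto simp: a1_def intro: subF_add)
  have zero: "qform a1 x + tr ((b + b') * x) = 0" for x
  proof (cases "x = 0")
    case False
    then obtain i where i: "i < 2 ^ m - 1" "x = inverse (\<pi> ^ i)"
      using bij_primitive_powers[OF \<pi>] by (auto simp: bij_betw_def image_iff set_eq_iff)
    have "word \<pi> (a, b) ! i = word \<pi> (a', b') ! i" using eq by simp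
    then have iff: "qform a x + tr (b * x) \<noteq> 0 \<longleftrightarrow> qform a' x + tr (b' * x) \<noteq> 0"
      using i by (simp add: word_def)
    have "qform a x + tr (b * x) \<in> {0, 1}" "qform a' x + tr (b' * x) \<in> {0, 1}"
      unfolding subF_2[symmetric]
      by (rule subF_add[OF qform_subF[of a, OF a0(1)] tr_subF], rule subF_add[OF qform_subF[of a', OF a0(2)] tr_subF])
    then have "qform a x + tr (b * x) = qform a' x + tr (b' * x)" using iff by auto
    then have "(qform a x + tr (b * x)) + (qform a' x + tr (b' * x)) = 0" by simp
    moreover have "qform a1 x = qform a x + qform a' x" unfolding a1_def by (rule qform_add_left)
    ultimately show ?thesis by (simp add: distrib_right tr_add add.assoc add.left_commute)
  qed simp
  then have "chr a1 (b + b') x = 1" for x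
    using sgn2_form[of a1, OF a0(3), of x "b + b'"] by (simp add: sgn2_def)
  then have "S a1 (b + b') = 2 ^ m" by (simp add: S_def card_field)
  then have a1: "a1 i = 0" if "i < k" for i using S_maximal[of a1, OF a0(3)] that by blast
  then have "a i = a' i" if "i < k" for i using that by (simp add: a1_def add_eq_0)
  then have aa: "a = a'" using a unfolding Y_def
    by (intro PiE_ext[of _ "{..<k}" "\<lambda>_. UNIV"]) (auto simp: PiE_iff)
  have "qform a1 x = 0" for x using a1 k_pos by (simp add: qform_def)
  then have "tr ((b + b') * x) = 0" for x using zero[of x] by simp
  then have "b = b'" using tr_nondegenerate add_eq_0 by blast
  with aa show "a = a' \<and> b = b'" by simp
qed

lemma alpha_eq:
  assumes \<pi>: "primitive_elem (\<pi> :: 'a)" and j: "j < k" and \<epsilon>: "\<epsilon> = 1 \<or> \<epsilon> = -1"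
  shows "real (alpha m n d e k \<pi> (m div e - 2 * j) \<epsilon>)
    = real (card {a\<in>Y. card (rad a) = q ^ (2 * j)}) * (1/2 * (2 ^ (m - 2 * e * j) + of_int \<epsilon> * 2 ^ (n - e * j)))"
proof -
  let ?R = "\<epsilon> * 2 ^ (n + e * j)"
  have js: "j < s" using j k_le by simp
  have ejn: "e * j < n" using js e_pos by (simp add: n_eq)
  have ex: "m - e * (m div e - 2 * j) div 2 = n + e * j"
  proof -
    have "m div e - 2 * j = 2 * (s - j)" using e_pos by (simp add: m_eq diff_mult_distrib2)
    then have "e * (m div e - 2 * j) div 2 = n - e * j" by (simp add: n_eq diff_mult_distrib2)
    then show ?thesis using ejn by (simp add: mn)
  qed
  \<comment> \<open>The zero word has exponential sum \<open>2 ^ m\<close>, too large because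
    \<open>e * j < n\<close>; excluding it removes nothing.\<close>
  have nz: "word \<pi> (a, b) \<noteq> replicate (2 ^ m - 1) False" if a: "a \<in> Y" and S: "S a b = ?R" for a b
  proof
    assume "word \<pi> (a, b) = replicate (2 ^ m - 1) False"
    then have "DC (word \<pi> (a, b)) = int (2 ^ m - 1)" by (simp add: DC_def sum_list_replicate)
    then have "S a b = 2 ^ m" using DC_word[OF \<pi> a, of b] by (simp add: of_nat_diff)
    then have "?R = 2 ^ m" using S by simp
    moreover have "(0::int) < 2 ^ m" "(0::int) < 2 ^ (n + e * j)" by simp_all
    ultimately have "(2::int) ^ (n + e * j) = 2 ^ m" using \<epsilon> by (elim disjE; clarify; linarith)
    then have "n + e * j = m" by simp
    then show False using ejn by (simp add: mn)
  qed
  have "{c \<in> code m n d e k \<pi>. c \<noteq> replicate (2 ^ m - 1) False \<and> DC c = -1 + ?R}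
      = word \<pi> ` (SIGMA a:Y. {b. S a b = ?R})"
    unfolding code_eq using nz by (auto simp: DC_word[OF \<pi>] image_iff)
  then have "alpha m n d e k \<pi> (m div e - 2 * j) \<epsilon> = card (word \<pi> ` (SIGMA a:Y. {b. S a b = ?R}))"
    by (simp only: alpha_def ex)
  also have "\<dots> = card (SIGMA a:Y. {b. S a b = ?R})"
    by (rule card_image[OF inj_on_subset[OF inj_word[OF \<pi>]]]) auto
  also have "\<dots> = (\<Sum>a\<in>Y. card {b. S a b = ?R})" using finite_Y by (intro card_SigmaI) auto
  finally have "real (alpha m n d e k \<pi> (m div e - 2 * j) \<epsilon>) = (\<Sum>a\<in>Y. real (card {b. S a b = ?R}))" by simp
  also have "\<dots> = (\<Sum>a\<in>Y. if card (rad a) = q ^ (2 * j)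
      then 1/2 * (2 ^ (m - 2 * e * j) + of_int \<epsilon> * 2 ^ (n - e * j)) else 0)"
  proof (rule sum.cong[OF refl])
    fix a assume a: "a \<in> Y"
    show "real (card {b. S a b = ?R}) = (if card (rad a) = q ^ (2 * j)
      then 1/2 * (2 ^ (m - 2 * e * j) + of_int \<epsilon> * 2 ^ (n - e * j)) else 0)"
    proof (cases "card (rad a) = q ^ (2 * j)")
      case True
      then show ?thesis using card_S_eq[of a, OF Y_0[OF a] True _ \<epsilon>] js by simp
    next
      case False
      \<comment> \<open>A radical of another size yields only zero or a power of two with a
        different exponent, up to sign.\<close>
      obtain i where i: "card (rad a) = q ^ (2 * i)" using card_rad[OF a] by blast
      have "i \<noteq> j" using False i by auto
      then have "(2::int) ^ (n + e * i) \<noteq> 2 ^ (n + e * j)" using e_pos by simp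
      moreover have "(0::int) < 2 ^ (n + e * i)" "(0::int) < 2 ^ (n + e * j)" by simp_all
      ultimately have "S a b \<noteq> ?R" for b
        using S_values[of a, OF Y_0[OF a] i, of b] \<epsilon> by (elim disjE; clarify; linarith)
      then show ?thesis using False by simp
    qed
  qed
  finally show ?thesis using finite_Y by (simp add: sum.If_cases Int_def)
qed

end

theorem theorem1p2:
  fixes \<pi> :: "'a::{field,finite}"
    and m n d e k j :: nat and \<epsilon> :: int
  assumes "CARD('a) = 2 ^ m"
    and "primitive_elem \<pi>"
    and "0 < m" "0 < n" "0 < d" "0 < e" "0 < k"
    and "m = 2 * n" "e = gcd n d" "e = gcd m d"
    and "1 \<le> k" "k \<le> n div e"
    and "j < k"
    and "\<epsilon> = 1 \<or> \<epsilon> = -1"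
  shows "real (alpha m n d e k \<pi> (m div e - 2 * j) \<epsilon>) =
    1/2 * (2 ^ (m - 2 * e * j) + of_int \<epsilon> * 2 ^ (m div 2 - e * j)) *
    (\<Sum>v = j..k-1. (-1) ^ (v - j) * 4 ^ (e * ((v - j) choose 2))
        * gauss_binom (4 ^ e) v j * gauss_binom (4 ^ e) (m div (2 * e)) v
        * (2 ^ (n * (2 * k - 1 - 2 * v) + e * v) - 1))"
proof -
  define s where "s = n div e"
  define d' where "d' = d div e"
  have n: "n = e * s" using assms(9) by (simp add: s_def)
  have d: "d = e * d'" using assms(9) by (simp add: d'_def)
  have m: "m = e * (2 * s)" using assms(8) n by simp
  \<comment> \<open>Since \<open>m\<close> contains the factor two, \<open>gcd m d = e\<close> gives
    coprimality of \<open>d'\<close> with \<open>2 * s\<close>, and with it oddness.\<close>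
  have "gcd m d = e * gcd (2 * s) d'" unfolding m d by (rule gcd_mult_distrib_nat[symmetric])
  then have "e * 1 = e * gcd (2 * s) d'" using assms(10) by (simp only: mult_1_right)
  then have "gcd (2 * s) d' = 1" using assms(6) by (metis mult_left_cancel less_irrefl)
  then have cop: "coprime d' (2 * s)" by (simp add: coprime_iff_gcd_eq_1 gcd.commute)
  then have "odd d'" by simp
  then interpret norm_form_code "TYPE('a)" m n d e k s d'
  proof unfold_locales
    show "CARD('a) = 2 ^ m" "0 < m" "m = e * (2 * s)" "n = e * s" "d = e * d'" "odd d'" "coprime d' (2 * s)"
      "0 < e" "0 < k" "k \<le> s"
      using assms(1,3,6,7,12) m n d cop \<open>odd d'\<close> unfolding s_def[symmetric] by blast+
  qed
  have half: "m div 2 = n" "m div (2 * e) = s" using assms(6,8) by (simp_all add: n)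
  show ?thesis
    unfolding half alpha_eq[OF assms(2,13,14)] radical_distribution[OF assms(13)] by (rule mult.commute)
qed

end
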